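(* Consider the DISFOM algorithm with distance term $\phi=\delta_{\bar X}$, the indicator function of $\bar X=\{\mathbf{z}\in\mathbb{R}^d:\|\mathbf{z}\|_1\le\psi\}$, and the minibatch gradient estimate $G^k=\frac1m\sum_{i=1}^m\nabla F(\mathbf{x}^k,\zeta_i^k)$, as described in the context, under assumptions (A1)-(A4). Let $\epsilon>0$ and choose $$\eta=\frac1L,\quad K=\left\lceil\frac{\Delta L}{\epsilon^2}\right\rceil,\quad m=\left\lceil\frac{c(\log d)\sigma_\infty^2}{\epsilon^2}\right\rceil,\quad\hat\epsilon=\frac{\epsilon}{L},\quad\psi=2\hat\epsilon$$ (the auxiliary constants of the analysis being $\gamma=\frac12$, $\tau=t=\frac1L$). Then $$\mathbb{E}\big[\mathrm{dist}_{\|\cdot\|_\infty}(0,\partial(f+\delta_X)(\mathbf{x}^{Y+1}))\big]\le C\epsilon ,$$ where $C$ is an absolute constant, and the sample complexity (total number of samples of $\zeta$ used) is $$Km=\mathcal{O}\left(\frac{\Delta L\,c(\log d)\sigma_\infty^2}{\epsilon^4}\right).$$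
   Context: Problem: minimize $f(\mathbf{x})=\mathbb{E}[F(\mathbf{x},\zeta)]$ over a nonempty closed convex set $X\subseteq\mathbb{R}^d$, $d\ge2$, where $\zeta$ is a random vector, $F(\cdot,\zeta)$ and $f$ are real-valued and differentiable on $\mathbb{R}^d$ ($f$ possibly nonconvex). $\|\cdot\|$ is the Euclidean norm. Assumptions. (A1) A stochastic first-order oracle returns $\nabla F(\mathbf{x},\zeta)$ for any input $(\mathbf{x},\zeta)$. (A2) With $w(\mathbf{x})=\nabla F(\mathbf{x},\zeta)-\nabla f(\mathbf{x})$: $\mathbb{E}[w(\mathbf{x})]=0$ and $\mathbb{E}[\exp(t\,w_i(\mathbf{x}))]\le\exp(\sigma_\infty^2t^2/2)$ for all $t\in\mathbb{R}$, $i=1,\dots,d$, $\mathbf{x}\in X$. (A3) $\|\nabla F(\mathbf{x},\zeta)-\nabla F(\mathbf{y},\zeta)\|\le L\|\mathbf{x}-\mathbf{y}\|$ for all $\mathbf{x},\mathbf{y}\in X$ and all $\zeta$, with $L>0$. (A4) $f(\mathbf{x})\ge\underline f$ for all $\mathbf{x}\in X$. Algorithm (DISFOM). Given an integer $K\ge1$, stepsize $\eta>0$, tolerance $\hat\epsilon\ge0$, and a (possibly random) $\mathbf{x}^1\in X$ with $\mathbb{E}[f(\mathbf{x}^1)]$ finite, for $k=1,\dots,K$: form a gradient estimate $G^k$, and compute $\mathbf{x}^{k+1}\in X$ as an approximate solution of $\min_{\mathbf{x}\in X}\frac12\|\mathbf{x}-(\mathbf{x}^k-\eta G^k)\|^2+\phi(\mathbf{x}-\mathbf{x}^k)$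 in the sense that there exist $\xi^{k+1},\Gamma^{k+1},\mathbf{y}^{k+1}\in\mathbb{R}^d$ with $(\mathbf{x}^{k+1}-\mathbf{x}^k+\eta G^k+\xi^{k+1}+\Gamma^{k+1})^T(\mathbf{x}-\mathbf{x}^{k+1})\ge0$ for all $\mathbf{x}\in X$; $\xi^{k+1}\in\partial\phi(\mathbf{y}^{k+1}-\mathbf{x}^k)$; $\|\Gamma^{k+1}\|\le\hat\epsilon$; $\|\mathbf{x}^{k+1}-\mathbf{y}^{k+1}\|_1\le\hat\epsilon$. Output $\mathbf{x}^{Y+1}$ with $Y$ uniform on $\{1,\dots,K\}$, independent of everything else. The samples $\zeta_i^k$ are i.i.d. copies of $\zeta$, those drawn at iteration $k$ being independent of $\mathbf{x}^1,\dots,\mathbf{x}^k$. Notation: $\Delta=\mathbb{E}[f(\mathbf{x}^1)]-\underline f$; $\delta_S$ denotes the indicator function of a set $S$ ($0$ on $S$, $+\infty$ off $S$); $\partial(f+\delta_X)(\mathbf{x})=\nabla f(\mathbf{x})+N_X(\mathbf{x})$ for $\mathbf{x}\in X$, with $N_X$ the normal cone; $\mathrm{dist}_{\|\cdot\|_\infty}(0,S)=\inf\{\|\mathbf{v}\|_\infty:\mathbf{v}\in S\}$. $c>0$ is an absolute constant such that, for every $d\ge2$ and $m\ge1$, the average $\bar w$ of $m$ i.i.d. mean-zero random vectors in $\mathbb{R}^d$ whose components satisfy the sub-Gaussian bound in (A2) satisfies $\mathbb{E}\|\bar w\|_\infty^2\le c(\log d)\sigma_\infty^2/m$ (such a $c$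 exists, e.g. $c=12$). $\Delta$ and $\sigma_\infty$ are positive. $\mathcal{O}(\cdot)$ hides absolute constants and is understood for sufficiently small $\epsilon$. *)

theory Defs
  imports "HOL-Probability.Probability"
begin

definition grad :: "('a::real_inner \<Rightarrow> real) \<Rightarrow> 'a \<Rightarrow> 'a" where
  "grad g x = (THE D. GDERIV g x :> D)"

definition norm1 :: "real ^ 'n \<Rightarrow> real" where
  "norm1 x = (\<Sum>i\<in>UNIV. \<bar>x $ i\<bar>)"

definition delta :: "'a set \<Rightarrow> 'a \<Rightarrow> ereal" where
  "delta S x = (if x \<in> S then 0 else \<infinity>)"

definition subdifferential :: "('a::real_inner \<Rightarrow> ereal) \<Rightarrow> 'a \<Rightarrow> 'a set" where
  "subdifferential \<phi> x =
     {v. \<bar>\<phi> x\<bar> \<noteq> \<infinity> \<and> (\<forall>y. \<phi> x + ereal (v \<bullet> (y - x)) \<le> \<phi> y)}"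

definition normal_cone :: "'a::real_inner set \<Rightarrow> 'a \<Rightarrow> 'a set" where
  "normal_cone X x = {v. x \<in> X \<and> (\<forall>y\<in>X. v \<bullet> (y - x) \<le> 0)}"

text \<open>The subdifferential of \<open>f + delta X\<close> for a differentiable, possibly nonconvex
  \<open>f\<close> and a closed convex \<open>X\<close>.\<close>

definition constrained_subdiff :: "('a::real_inner \<Rightarrow> real) \<Rightarrow> 'a set \<Rightarrow> 'a \<Rightarrow> 'a set" where
  "constrained_subdiff f X x = {grad f x + v | v. v \<in> normal_cone X x}"

text \<open>Distance from the origin to \<open>S\<close> in the maximum norm.\<close>

definition infdist0 :: "(real ^ 'n) set \<Rightarrow> real" where
  "infdist0 S = (INF v\<in>S. infnorm v)"

definition objective ::
  "'w measure \<Rightarrow> ('w \<Rightarrow> 'z) \<Rightarrow> ('a \<Rightarrow> 'z \<Rightarrow> real) \<Rightarrow> 'a \<Rightarrow> real" where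
  "objective M \<zeta> F x = (\<integral>\<omega>. F x (\<zeta> \<omega>) \<partial>M)"

definition subgaussian :: "'w measure \<Rightarrow> real \<Rightarrow> ('w \<Rightarrow> real) \<Rightarrow> bool" where
  "subgaussian M \<sigma> W \<longleftrightarrow>
     (\<forall>t. integrable M (\<lambda>\<omega>. exp (t * W \<omega>)) \<and>
          (\<integral>\<omega>. exp (t * W \<omega>) \<partial>M) \<le> exp (\<sigma>\<^sup>2 * t\<^sup>2 / 2))"

text \<open>
  \<open>c\<close> bounds the second moment of the maximum norm of an average of \<open>m\<close> i.i.d. centred
  sub-Gaussian vectors, uniformly in the dimension \<open>d\<close>. To quantify over \<open>d\<close> inside the
  formula, a vector in dimension \<open>d\<close> is a point of the product space over \<open>{..<d}\<close>.
  The expectation depends only on the common law \<open>\<mu>\<close> of the vectors, so the vectors are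
  realized as the coordinates \<open>W j\<close> of the \<open>m\<close>-fold product of \<open>\<mu>\<close>.
\<close>

definition maximal_const :: "real \<Rightarrow> bool" where
  "maximal_const c \<longleftrightarrow>
     (\<forall>(d::nat) \<ge> 2. \<forall>(m::nat) \<ge> 1. \<forall>\<sigma> > 0. \<forall>\<mu> :: (nat \<Rightarrow> real) measure.
        prob_space \<mu> \<longrightarrow>
        sets \<mu> = sets (PiM {..<d} (\<lambda>_. borel)) \<longrightarrow>
        (\<forall>i<d. has_bochner_integral \<mu> (\<lambda>w. w i) 0) \<longrightarrow>
        (\<forall>i<d. subgaussian \<mu> \<sigma> (\<lambda>w. w i)) \<longrightarrow>
        (\<integral>\<^sup>+ W. ennreal ((MAX i\<in>{..<d}. \<bar>(\<Sum>j<m. W j i) / real m\<bar>)\<^sup>2)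
            \<partial>(PiM {..<m} (\<lambda>_. \<mu>)))
          \<le> ennreal (c * ln (real d) * \<sigma>\<^sup>2 / real m))"

text \<open>
  \<open>\<Xi>\<close> is the set of values of the random vector \<open>\<zeta>\<close>. Joint measurability of the
  stochastic gradient is not assumed: it follows from \<open>F_measurable\<close>, differentiability
  and \<open>grad_lipschitz\<close>.
\<close>

locale stochastic_problem = prob_space M
  for M :: "'w measure" +
  fixes \<Xi> :: "'z::euclidean_space set"
    and \<zeta> :: "'w \<Rightarrow> 'z"
    and F :: "real ^ 'n \<Rightarrow> 'z \<Rightarrow> real"
    and X :: "(real ^ 'n) set"
    and L \<sigma> f_low :: real
  assumes dim_ge_2: "2 \<le> CARD('n)"
    and X_nonempty: "X \<noteq> {}"
    and X_closed: "closed X"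
    and X_convex: "convex X"
    and zeta_measurable: "\<zeta> \<in> M \<rightarrow>\<^sub>M restrict_space borel \<Xi>"
    and F_measurable: "\<And>x. F x \<in> borel_measurable (restrict_space borel \<Xi>)"
    and F_integrable: "\<And>x. integrable M (\<lambda>\<omega>. F x (\<zeta> \<omega>))"
    and F_differentiable: "\<And>x z. z \<in> \<Xi> \<Longrightarrow> (\<lambda>y. F y z) differentiable (at x)"
    and f_differentiable: "\<And>x. objective M \<zeta> F differentiable (at x)"
    and noise_mean: "\<And>x. x \<in> X \<Longrightarrow>
      has_bochner_integral M
        (\<lambda>\<omega>. grad (\<lambda>y. F y (\<zeta> \<omega>)) x - grad (objective M \<zeta> F) x) 0"
    and noise_subgaussian: "\<And>x i. x \<in> X \<Longrightarrow>
      subgaussian M \<sigma>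
        (\<lambda>\<omega>. (grad (\<lambda>y. F y (\<zeta> \<omega>)) x - grad (objective M \<zeta> F) x) $ i)"
    and sigma_pos: "0 < \<sigma>"
    and grad_lipschitz: "\<And>x y z. x \<in> X \<Longrightarrow> y \<in> X \<Longrightarrow> z \<in> \<Xi> \<Longrightarrow>
      norm (grad (\<lambda>u. F u z) x - grad (\<lambda>u. F u z) y) \<le> L * norm (x - y)"
    and L_pos: "0 < L"
    and f_lower_bound: "\<And>x. x \<in> X \<Longrightarrow> f_low \<le> objective M \<zeta> F x"

definition minibatch_grad ::
  "(real ^ 'n \<Rightarrow> 'z \<Rightarrow> real) \<Rightarrow> nat \<Rightarrow> (nat \<Rightarrow> 'z) \<Rightarrow> real ^ 'n \<Rightarrow> real ^ 'n" where
  "minibatch_grad F m z x = (1 / real m) *\<^sub>R (\<Sum>i=1..m. grad (\<lambda>y. F y (z i)) x)"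

text \<open>\<open>x'\<close> is an admissible approximate solution of the subproblem at \<open>x\<close> with gradient
  estimate \<open>G\<close>.\<close>

definition disfom_step ::
  "(real ^ 'n) set \<Rightarrow> (real ^ 'n \<Rightarrow> ereal) \<Rightarrow> real \<Rightarrow> real \<Rightarrow>
   real ^ 'n \<Rightarrow> real ^ 'n \<Rightarrow> real ^ 'n \<Rightarrow> bool" where
  "disfom_step X \<phi> \<eta> eps_hat x G x' \<longleftrightarrow>
     x' \<in> X \<and>
     (\<exists>\<xi> \<Gamma> y.
        (\<forall>u\<in>X. (x' - x + \<eta> *\<^sub>R G + \<xi> + \<Gamma>) \<bullet> (u - x') \<ge> 0) \<and>
        \<xi> \<in> subdifferential \<phi> (y - x) \<and>
        norm \<Gamma> \<le> eps_hat \<and>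
        norm1 (x' - y) \<le> eps_hat)"

text \<open>
  A run with minibatch gradients: \<open>x k\<close> are the iterates, \<open>Z k i\<close> is the \<open>i\<close>-th sample
  drawn at iteration \<open>k\<close>, and \<open>Y\<close> is the random output index. Independence across
  different value types is expressed through the generated sigma-algebras.
\<close>

locale disfom_run = stochastic_problem M \<Xi> \<zeta> F X L \<sigma> f_low
  for M :: "'w measure"
    and \<Xi> :: "'z::euclidean_space set"
    and \<zeta> :: "'w \<Rightarrow> 'z"
    and F :: "real ^ 'n \<Rightarrow> 'z \<Rightarrow> real"
    and X :: "(real ^ 'n) set"
    and L \<sigma> f_low :: real +
  fixes \<phi> :: "real ^ 'n \<Rightarrow> ereal"
    and \<eta> eps_hat :: real
    and K m :: nat
    and x :: "nat \<Rightarrow> 'w \<Rightarrow> real ^ 'n"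
    and Z :: "nat \<Rightarrow> nat \<Rightarrow> 'w \<Rightarrow> 'z"
    and Y :: "'w \<Rightarrow> nat"
  assumes K_pos: "1 \<le> K"
    and m_pos: "1 \<le> m"
    and eta_pos: "0 < \<eta>"
    and eps_hat_nonneg: "0 \<le> eps_hat"
    and x_measurable: "\<And>k. k \<in> {1..Suc K} \<Longrightarrow> x k \<in> borel_measurable M"
    and x1_in_X: "\<And>\<omega>. \<omega> \<in> space M \<Longrightarrow> x 1 \<omega> \<in> X"
    and f_x1_integrable: "integrable M (\<lambda>\<omega>. objective M \<zeta> F (x 1 \<omega>))"
    and step: "\<And>k \<omega>. k \<in> {1..K} \<Longrightarrow> \<omega> \<in> space M \<Longrightarrow>
      disfom_step X \<phi> \<eta> eps_hat (x k \<omega>)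
        (minibatch_grad F m (\<lambda>i. Z k i \<omega>) (x k \<omega>)) (x (Suc k) \<omega>)"
    and samples_distr: "\<And>k i. k \<in> {1..K} \<Longrightarrow> i \<in> {1..m} \<Longrightarrow>
      distr M (restrict_space borel \<Xi>) (Z k i) = distr M (restrict_space borel \<Xi>) \<zeta>"
    and samples_indep:
      "indep_vars (\<lambda>_. restrict_space borel \<Xi>) (\<lambda>p. Z (fst p) (snd p)) ({1..K} \<times> {1..m})"
    and samples_indep_past: "\<And>k. k \<in> {1..K} \<Longrightarrow>
      indep_set
        (sets (vimage_algebra (space M) (\<lambda>\<omega>. \<lambda>i\<in>{1..m}. Z k i \<omega>)
                 (PiM {1..m} (\<lambda>_. restrict_space borel \<Xi>))))
        (sets (vimage_algebra (space M) (\<lambda>\<omega>. \<lambda>j\<in>{1..k}. x j \<omega>)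
                 (PiM {1..k} (\<lambda>_. borel))))"
    and Y_measurable: "Y \<in> M \<rightarrow>\<^sub>M count_space {1..K}"
    and Y_uniform: "distr M (count_space {1..K}) Y = uniform_count_measure {1..K}"
    and Y_indep:
      "indep_set
        (sets (vimage_algebra (space M) Y (count_space {1..K})))
        (sets (vimage_algebra (space M)
                 (\<lambda>\<omega>. (\<lambda>k\<in>{1..Suc K}. x k \<omega>,
                       \<lambda>p\<in>{1..K} \<times> {1..m}. Z (fst p) (snd p) \<omega>))
                 (PiM {1..Suc K} (\<lambda>_. borel) \<Otimes>\<^sub>M
                  PiM ({1..K} \<times> {1..m}) (\<lambda>_. restrict_space borel \<Xi>))))"

end

theory Submission
  imports Defs
begin

text \<open>
  Write \<open>h = \<epsilon> / L\<close>, \<open>s = x' - x\<close> for one step and \<open>w = G - grad f x\<close> for the error of the gradient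
  estimate. The distance term is the indicator of the \<open>l\<^sub>1\<close> ball of radius \<open>2 h\<close>, so \<open>\<xi>\<close> is a multiplier
  of the constraint \<open>norm1 (y - x) \<le> 2 h\<close>. Two facts about \<open>\<xi>\<close> drive the proof.

  Duality of \<open>l\<^sub>1\<close> and \<open>l\<^sub>\<infinity>\<close> gives \<open>\<xi> \<bullet> (y - x) \<ge> 2 h * infnorm \<xi>\<close>, and replacing \<open>y\<close> by \<open>x'\<close> costs
  at most \<open>h * infnorm \<xi>\<close>, so \<open>\<xi> \<bullet> s \<ge> h * infnorm \<xi>\<close>. Testing the variational inequality at \<open>u = x\<close>
  and using the descent inequality for the \<open>L\<close>-smooth \<open>f\<close> then bounds \<open>L * infnorm \<xi>\<close> by
  \<open>L / \<epsilon> * (f x - f x')\<close> plus terms of order \<open>\<epsilon>\<close> and \<open>infnorm w\<close>. On the other hand, the variational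
  inequality says that \<open>grad f x' - G - L (s + \<xi> + \<Gamma>)\<close> belongs to the subdifferential of
  \<open>f + \<delta>\<^sub>X\<close> at \<open>x'\<close>; since \<open>norm1 s \<le> 3 h\<close>, all parts of it other than \<open>L \<xi>\<close> are again of
  order \<open>\<epsilon>\<close> and \<open>infnorm w\<close>. Together (\<open>disfom_step_stationarity\<close>), the distance at \<open>x'\<close> is at most
  \<open>15/2 \<epsilon> + 4 infnorm w + L / \<epsilon> * (f x - f x')\<close>.

  The noise enters only through its maximum norm, because it is paired with \<open>s\<close>, whose \<open>l\<^sub>1\<close> norm is
  controlled; this is where the dimension is reduced to its logarithm. As the minibatch is independent
  of the current iterate, Fubini reduces the expectation to a fixed point of \<open>X\<close>, where the maximal
  inequality behind \<open>c\<close> applies, and the choice of \<open>m\<close> yields an expected \<open>infnorm w\<close> of at most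
  \<open>\<epsilon>\<close> (\<open>noise_second_moment\<close>, \<open>noise_first_moment\<close>).

  Averaging over the uniform independent index makes the decreases of \<open>f\<close> telescope; they contribute
  \<open>L \<Delta> / (\<epsilon> K) \<le> \<epsilon>\<close>. The total is \<open>(15/2 + 4 + 1) \<epsilon> \<le> 13 \<epsilon>\<close>.

  Measurability needs two arguments of its own. Gradients are limits of difference quotients of a
  function that is measurable in the sample and continuous in the point, hence jointly measurable. The
  distance to the subdifferential is lower semicontinuous on \<open>X\<close>, because the normal cone has a
  closed graph.
\<close>

section \<open>Gradients and their measurability\<close>

lemma gderiv_unique:
  assumes "GDERIV g x :> D" "GDERIV g x :> D'"
  shows "D = D'"
proof -
  have "(\<lambda>h. h \<bullet> D) = (\<lambda>h. h \<bullet> D')"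
    using assms unfolding gderiv_def by (rule has_derivative_unique)
  then have "(D - D') \<bullet> D = (D - D') \<bullet> D'" by metis
  then have "(D - D') \<bullet> (D - D') = 0" by (simp add: inner_diff_right)
  then show ?thesis by simp
qed

text \<open>
  The gradient is the Riesz representative of the derivative, assembled from its values on the basis.
\<close>

lemma gderiv_grad:
  fixes g :: "'a::euclidean_space \<Rightarrow> real"
  assumes "g differentiable (at x)"
  shows "GDERIV g x :> grad g x"
proof -
  obtain g' where g': "(g has_derivative g') (at x)"
    using assms by (auto simp: differentiable_def)
  interpret g': linear g' using g' by (rule has_derivative_linear)
  have "g' h = h \<bullet> (\<Sum>b\<in>Basis. g' b *\<^sub>R b)" for h
  proof -
    have "g' h = g' (\<Sum>b\<in>Basis. (h \<bullet> b) *\<^sub>R b)" by (simp add: euclidean_representation)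
    also have "\<dots> = (\<Sum>b\<in>Basis. (h \<bullet> b) * g' b)" by (simp add: g'.sum g'.scaleR)
    finally show ?thesis by (simp add: inner_sum_right mult.commute)
  qed
  then have "g' = (\<lambda>h. h \<bullet> (\<Sum>b\<in>Basis. g' b *\<^sub>R b))" by (rule ext)
  then have D: "GDERIV g x :> (\<Sum>b\<in>Basis. g' b *\<^sub>R b)"
    unfolding gderiv_def by (rule has_derivative_eq_rhs[OF g'])
  then show ?thesis
    unfolding grad_def by (rule theI) (rule gderiv_unique[OF _ D])
qed

text \<open>
  Exhibits a partial derivative as a limit along a sequence, which is the form in which measurability
  is inherited.
\<close>

lemma grad_component_limit:
  fixes g :: "real ^ 'n \<Rightarrow> real"
  assumes "g differentiable (at x)"
  shows "(\<lambda>k. real (Suc k) * (g (x + (1 / real (Suc k)) *\<^sub>R axis i 1) - g x))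
           \<longlonglongrightarrow> grad g x $ i"
proof -
  define \<gamma> where "\<gamma> t = x + t *\<^sub>R axis i (1::real)" for t
  have "(g has_derivative (\<lambda>h. h \<bullet> grad g x)) (at (\<gamma> 0))"
    using gderiv_grad[OF assms] by (simp add: gderiv_def \<gamma>_def)
  moreover have "(\<gamma> has_derivative (\<lambda>t. t *\<^sub>R axis i 1)) (at 0)"
    unfolding \<gamma>_def by (auto intro!: derivative_eq_intros)
  ultimately have "((\<lambda>t. g (\<gamma> t)) has_derivative (\<lambda>t. (t *\<^sub>R axis i 1) \<bullet> grad g x)) (at 0)"
    by (intro has_derivative_compose[of \<gamma> _ 0 UNIV g])
  then have "((\<lambda>t. g (\<gamma> t)) has_field_derivative grad g x $ i) (at 0)"
    by (simp add: has_field_derivative_def inner_axis' mult_commute_abs)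
  then have lim: "((\<lambda>h. (g (\<gamma> h) - g (\<gamma> 0)) / h) \<longlongrightarrow> grad g x $ i) (at 0)"
    by (simp add: DERIV_def)
  have "filterlim (\<lambda>k. 1 / real (Suc k)) (at 0) sequentially"
    using LIMSEQ_Suc[OF lim_1_over_n[where 'a=real]] by (auto simp: filterlim_at)
  from filterlim_compose[OF lim this] show ?thesis
    by (simp add: \<gamma>_def mult.commute)
qed

text \<open>
  Approximating the identity by simple functions \<open>s k\<close> reduces joint measurability to sections: each
  \<open>g (s k x) z\<close> is glued from finitely many sections, and continuity in \<open>x\<close> passes to the limit.
\<close>

lemma measurable_caratheodory:
  fixes g :: "'a::{metric_space, second_countable_topology} \<Rightarrow> 'z \<Rightarrow> 'b::metric_space"
  assumes meas: "\<And>x. g x \<in> borel_measurable N"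
    and cont: "\<And>x z. z \<in> space N \<Longrightarrow> isCont (\<lambda>y. g y z) x"
  shows "(\<lambda>(x, z). g x z) \<in> borel_measurable (borel \<Otimes>\<^sub>M N)"
proof -
  obtain s :: "nat \<Rightarrow> 'a \<Rightarrow> 'a" where s: "\<And>k. simple_function borel (s k)" "\<And>x. (\<lambda>k. s k x) \<longlonglongrightarrow> x"
    using borel_measurable_implies_sequence_metric[of "\<lambda>x. x" borel undefined] by auto
  show ?thesis
  proof (rule borel_measurable_LIMSEQ_metric)
    fix k
    have "(\<lambda>p :: 'a \<times> 'z. g (s k (fst p)) (snd p)) \<in> borel_measurable (borel \<Otimes>\<^sub>M N)"
    proof (rule measurable_compose_countable'[where f="\<lambda>y p. g y (snd p)" and I="s k ` UNIV"])
      show "countable (range (s k))"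
        using simple_functionD(1)[OF s(1)[of k]] by (simp add: countable_finite)
      show "(\<lambda>p. s k (fst p)) \<in> borel \<Otimes>\<^sub>M N \<rightarrow>\<^sub>M count_space (range (s k))"
        using s(1)[of k]
        by (intro measurable_compose[OF measurable_fst] measurable_count_space_eq2[THEN iffD2])
           (auto dest: simple_functionD)
    qed (use meas in measurable)
    then show "(\<lambda>(x, z). g (s k x) z) \<in> borel_measurable (borel \<Otimes>\<^sub>M N)"
      by (simp add: case_prod_beta)
  next
    fix p :: "'a \<times> 'z" assume "p \<in> space (borel \<Otimes>\<^sub>M N)"
    then have "isCont (\<lambda>y. g y (snd p)) (fst p)"
      by (intro cont) (auto simp: space_pair_measure)
    from isCont_tendsto_compose[OF this s(2)]
    show "(\<lambda>k. case p of (x, z) \<Rightarrow> g (s k x) z) \<longlonglongrightarrow> (case p of (x, z) \<Rightarrow> g x z)"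
      by (simp add: case_prod_beta)
  qed
qed

text \<open>
  Differentiability makes \<open>g\<close> continuous in the point, so the preceding lemma applies to the difference
  quotients, and joint measurability passes to their limit.
\<close>

lemma grad_measurable:
  fixes g :: "real ^ 'n \<Rightarrow> 'z \<Rightarrow> real"
  assumes meas: "\<And>x. g x \<in> borel_measurable N"
    and diff: "\<And>x z. z \<in> space N \<Longrightarrow> (\<lambda>y. g y z) differentiable (at x)"
  shows "(\<lambda>(x, z). grad (\<lambda>y. g y z) x) \<in> borel_measurable (borel \<Otimes>\<^sub>M N)"
proof -
  have joint: "(\<lambda>(x, z). g x z) \<in> borel_measurable (borel \<Otimes>\<^sub>M N)"
    using meas diff by (intro measurable_caratheodory differentiable_imp_continuous_within)
  have shifted: "(\<lambda>(x, z). g (x + a) z) \<in> borel_measurable (borel \<Otimes>\<^sub>M N)" for a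
    using measurable_compose[OF _ joint, of "\<lambda>(x, z). (x + a, z)" "borel \<Otimes>\<^sub>M N"]
    by (simp add: case_prod_beta)
  have component: "(\<lambda>p. grad (\<lambda>y. g y (snd p)) (fst p) $ i) \<in> borel_measurable (borel \<Otimes>\<^sub>M N)" for i
  proof (rule borel_measurable_LIMSEQ_real)
    fix p :: "(real ^ 'n) \<times> 'z" assume "p \<in> space (borel \<Otimes>\<^sub>M N)"
    then show "(\<lambda>k. real (Suc k) * (g (fst p + (1 / real (Suc k)) *\<^sub>R axis i 1) (snd p)
                  - g (fst p) (snd p))) \<longlonglongrightarrow> grad (\<lambda>y. g y (snd p)) (fst p) $ i"
      by (intro grad_component_limit[where g="\<lambda>y. g y (snd p)"] diff) (auto simp: space_pair_measure)
  next
    fix k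
    show "(\<lambda>p :: (real ^ 'n) \<times> 'z. real (Suc k) * (g (fst p + (1 / real (Suc k)) *\<^sub>R axis i 1) (snd p)
                  - g (fst p) (snd p))) \<in> borel_measurable (borel \<Otimes>\<^sub>M N)"
      using joint shifted by (simp add: case_prod_beta)
  qed
  show ?thesis
    by (rule borel_measurable_euclidean_space[THEN iffD2])
       (auto simp: Basis_vec_def inner_axis case_prod_beta intro: component)
qed

section \<open>Duality of the sum norm and the maximum norm\<close>

lemma holder_infnorm_norm1:
  fixes a b :: "real ^ 'n"
  shows "\<bar>a \<bullet> b\<bar> \<le> infnorm a * norm1 b"
proof -
  have "\<bar>a \<bullet> b\<bar> \<le> (\<Sum>i\<in>UNIV. \<bar>a $ i\<bar> * \<bar>b $ i\<bar>)"
    unfolding inner_vec_def by (rule order_trans[OF sum_abs]) (simp add: abs_mult)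
  also have "\<dots> \<le> (\<Sum>i\<in>UNIV. infnorm a * \<bar>b $ i\<bar>)"
    by (intro sum_mono mult_right_mono component_le_infnorm_cart) auto
  finally show ?thesis by (simp add: norm1_def sum_distrib_left)
qed

lemma norm_le_norm1: "norm x \<le> norm1 x"
  unfolding norm1_def by (rule norm_le_l1_cart)

lemma norm1_triangle: "norm1 (x + y) \<le> norm1 x + norm1 y"
  unfolding norm1_def by (simp flip: sum.distrib add: sum_mono abs_triangle_ineq)

lemma infnorm_attained:
  fixes a :: "real ^ 'n"
  obtains i where "infnorm a = \<bar>a $ i\<bar>"
proof -
  have "infnorm a \<in> (\<lambda>b. \<bar>a \<bullet> b\<bar>) ` Basis"
    unfolding infnorm_Max by (rule Max_in) auto
  with that show ?thesis by (auto simp: Basis_vec_def inner_axis)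
qed

text \<open>
  A subgradient of the indicator of the \<open>l\<^sub>1\<close> ball is an outward normal of that ball, so its value at
  \<open>z\<close> is the maximum over the ball, which by duality is \<open>\<psi>\<close> times the maximum norm.
\<close>

lemma subdifferential_delta_norm1_ball:
  fixes \<xi> z :: "real ^ 'n"
  assumes \<xi>: "\<xi> \<in> subdifferential (delta {z. norm1 z \<le> \<psi>}) z" and "0 \<le> \<psi>"
  shows "norm1 z \<le> \<psi>" and "\<psi> * infnorm \<xi> \<le> \<xi> \<bullet> z"
proof -
  show z: "norm1 z \<le> \<psi>"
    using \<xi> by (auto simp: subdifferential_def delta_def split: if_splits)
  obtain i where i: "infnorm \<xi> = \<bar>\<xi> $ i\<bar>" by (rule infnorm_attained)
  \<comment> \<open>the vertex of the ball at which the linear functional \<open>\<xi>\<close> is largest\<close>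
  define y where "y = (\<psi> * sgn (\<xi> $ i)) *\<^sub>R axis i (1::real)"
  have "norm1 y = (\<Sum>j\<in>UNIV. if j = i then \<psi> * \<bar>sgn (\<xi> $ i)\<bar> else 0)"
    unfolding norm1_def y_def using \<open>0 \<le> \<psi>\<close>
    by (intro sum.cong) (auto simp: axis_def abs_mult)
  also have "\<dots> \<le> \<psi>" using \<open>0 \<le> \<psi>\<close> by (simp add: abs_sgn_eq)
  finally have "norm1 y \<le> \<psi>" .
  moreover have "delta {z. norm1 z \<le> \<psi>} z + ereal (\<xi> \<bullet> (y - z)) \<le> delta {z. norm1 z \<le> \<psi>} y"
    using \<xi> by (auto simp: subdifferential_def)
  ultimately have "\<xi> \<bullet> y \<le> \<xi> \<bullet> z"
    using z by (simp add: delta_def inner_diff_right)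
  moreover have "\<xi> \<bullet> y = \<psi> * infnorm \<xi>"
    by (simp add: y_def inner_axis i abs_sgn mult.commute mult.left_commute)
  ultimately show "\<psi> * infnorm \<xi> \<le> \<xi> \<bullet> z" by simp
qed

section \<open>The stationarity bound for one step\<close>

text \<open>
  The gradient is Lipschitz on \<open>X\<close> only, so the argument stays on the segment from \<open>x\<close> to \<open>y\<close>: the
  difference of \<open>f\<close> and its quadratic upper model is nonincreasing along it.
\<close>

lemma descent_lemma:
  fixes f :: "'a::euclidean_space \<Rightarrow> real"
  assumes diff: "\<And>x. f differentiable (at x)"
    and lip: "\<And>x y. x \<in> X \<Longrightarrow> y \<in> X \<Longrightarrow> norm (grad f x - grad f y) \<le> L * norm (x - y)"
    and "convex X" "x \<in> X" "y \<in> X"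
  shows "f y \<le> f x + grad f x \<bullet> (y - x) + L / 2 * (norm (y - x))\<^sup>2"
proof -
  define s where "s = y - x"
  define h where "h t = f (x + t *\<^sub>R s) - t * (grad f x \<bullet> s) - L / 2 * t\<^sup>2 * (norm s)\<^sup>2" for t
  have "\<exists>D. (h has_real_derivative D) (at t) \<and> D \<le> 0" if t: "0 \<le> t" "t \<le> 1" for t
  proof -
    let ?z = "x + t *\<^sub>R s"
    have z: "?z \<in> X"
      using convexD_alt[OF \<open>convex X\<close> \<open>x \<in> X\<close> \<open>y \<in> X\<close>, of t] t
      by (simp add: s_def algebra_simps)
    have "((\<lambda>t. f (x + t *\<^sub>R s)) has_derivative (\<lambda>u. (u *\<^sub>R s) \<bullet> grad f ?z)) (at t)"
      by (rule has_derivative_compose[OF _ gderiv_grad[OF diff, unfolded gderiv_def]])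
         (auto intro!: derivative_eq_intros)
    then have "((\<lambda>t. f (x + t *\<^sub>R s)) has_real_derivative grad f ?z \<bullet> s) (at t)"
      by (simp add: has_field_derivative_def inner_commute mult_commute_abs)
    then have "(h has_real_derivative (grad f ?z \<bullet> s - grad f x \<bullet> s - L * t * (norm s)\<^sup>2)) (at t)"
      unfolding h_def by (auto intro!: derivative_eq_intros)
    moreover have "grad f ?z \<bullet> s - grad f x \<bullet> s \<le> norm (grad f ?z - grad f x) * norm s"
      by (simp flip: inner_diff_left add: norm_cauchy_schwarz)
    moreover have "\<dots> \<le> L * norm (?z - x) * norm s"
      by (intro mult_right_mono lip z \<open>x \<in> X\<close>) auto
    ultimately show ?thesis
      using t by (auto simp: power2_eq_square mult.assoc)
  qed
  then have "h 1 \<le> h 0" by (intro DERIV_nonpos_imp_nonincreasing[of 0 1 h]) auto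
  then show ?thesis by (simp add: h_def s_def)
qed

lemma infdist0_le:
  assumes "v \<in> S"
  shows "infdist0 S \<le> infnorm v"
  unfolding infdist0_def using assms
  by (intro cINF_lower bdd_belowI[of _ 0]) (auto simp: infnorm_pos_le)

lemma infdist0_nonneg:
  assumes "S \<noteq> {}"
  shows "0 \<le> infdist0 S"
  unfolding infdist0_def using assms by (intro cINF_greatest) (auto simp: infnorm_pos_le)

lemma constrained_subdiff_nonempty: "x \<in> X \<Longrightarrow> constrained_subdiff f X x \<noteq> {}"
  by (auto simp: constrained_subdiff_def normal_cone_def intro!: exI[of _ 0])

text \<open>
  The deterministic heart of the proof: the subdifferential contains a vector whose only part that is
  not of order \<open>e\<close> or \<open>infnorm (G - grad f x)\<close> is the multiplier \<open>\<xi>\<close>, and the decrease of \<open>f\<close> pays for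
  \<open>\<xi>\<close>.
\<close>

lemma disfom_step_stationarity:
  fixes f :: "real ^ 'n \<Rightarrow> real"
  assumes diff: "\<And>x. f differentiable (at x)"
    and lip: "\<And>x y. x \<in> X \<Longrightarrow> y \<in> X \<Longrightarrow> norm (grad f x - grad f y) \<le> L * norm (x - y)"
    and "convex X" "0 < L" "0 < e" "x \<in> X"
    and step: "disfom_step X (delta {z. norm1 z \<le> 2 * (e / L)}) (1 / L) (e / L) x G x'"
  shows "infdist0 (constrained_subdiff f X x')
           \<le> 15 / 2 * e + 4 * infnorm (G - grad f x) + L / e * (f x - f x')"
proof -
  define s where "s = x' - x"
  define w where "w = G - grad f x"
  define h where "h = e / L"
  have h: "0 < h" "e = L * h" using \<open>0 < L\<close> \<open>0 < e\<close> by (auto simp: h_def)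
  obtain \<xi> \<Gamma> y where x': "x' \<in> X"
    and vi: "\<And>u. u \<in> X \<Longrightarrow> (s + (1 / L) *\<^sub>R G + \<xi> + \<Gamma>) \<bullet> (u - x') \<ge> 0"
    and \<xi>: "\<xi> \<in> subdifferential (delta {z. norm1 z \<le> 2 * h}) (y - x)"
    and \<Gamma>: "norm \<Gamma> \<le> h" and y: "norm1 (x' - y) \<le> h"
    using step unfolding disfom_step_def s_def h_def by auto
  note ball = subdifferential_delta_norm1_ball[OF \<xi>]
  have "norm1 s \<le> norm1 (y - x) + norm1 (x' - y)"
    using norm1_triangle[of "y - x" "x' - y"] by (simp add: s_def)
  then have s1: "norm1 s \<le> 3 * h" using ball(1) y h by auto
  then have s2: "norm s \<le> 3 * h" using norm_le_norm1[of s] by simp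

  \<comment> \<open>radius \<open>2 h\<close> minus inaccuracy \<open>h\<close> leaves a positive coefficient for the multiplier\<close>
  have "h * infnorm \<xi> \<le> \<xi> \<bullet> s"
  proof -
    have "\<bar>\<xi> \<bullet> (x' - y)\<bar> \<le> infnorm \<xi> * h"
      by (rule order_trans[OF holder_infnorm_norm1 mult_left_mono[OF y infnorm_pos_le]])
    moreover have "\<xi> \<bullet> s = \<xi> \<bullet> (y - x) + \<xi> \<bullet> (x' - y)"
      by (simp add: s_def inner_diff_right)
    ultimately show ?thesis using ball(2) h by (simp add: algebra_simps)
  qed
  \<comment> \<open>the variational inequality tested at \<open>u = x\<close>\<close>
  moreover have "s \<bullet> s + 1 / L * (G \<bullet> s) + \<xi> \<bullet> s + \<Gamma> \<bullet> s \<le> 0"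
    using vi[OF \<open>x \<in> X\<close>] by (simp add: s_def algebra_simps)
  moreover have "G \<bullet> s \<ge> f x' - f x - L / 2 * (norm s)\<^sup>2 - infnorm w * (3 * h)"
  proof -
    have "\<bar>w \<bullet> s\<bar> \<le> infnorm w * (3 * h)"
      by (rule order_trans[OF holder_infnorm_norm1 mult_left_mono[OF s1 infnorm_pos_le]])
    moreover have "G \<bullet> s = grad f x \<bullet> s + w \<bullet> s" by (simp add: w_def inner_diff_left)
    ultimately show ?thesis
      using descent_lemma[OF diff lip \<open>convex X\<close> \<open>x \<in> X\<close> x'] by (simp add: s_def)
  qed
  then have "1 / L * (G \<bullet> s) \<ge> 1 / L * (f x' - f x - L / 2 * (norm s)\<^sup>2 - infnorm w * (3 * h))"
    using \<open>0 < L\<close> by (intro mult_left_mono) auto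
  moreover have "1 / L * (f x' - f x - L / 2 * (norm s)\<^sup>2 - infnorm w * (3 * h))
      = (f x' - f x) / L - (norm s)\<^sup>2 / 2 - 3 * h * infnorm w / L"
    using \<open>0 < L\<close> by (simp add: field_simps)
  moreover have "\<Gamma> \<bullet> s \<ge> - (h * norm s)"
    using Cauchy_Schwarz_ineq2[of \<Gamma> s] mult_right_mono[OF \<Gamma> norm_ge_zero[of s]] by linarith
  \<comment> \<open>half of \<open>s \<bullet> s\<close> is spent on the descent inequality, the other half absorbs \<open>\<Gamma> \<bullet> s\<close>\<close>
  moreover have "h * norm s - (norm s)\<^sup>2 / 2 \<le> h\<^sup>2 / 2"
    using zero_le_power2[of "h - norm s"] by (simp add: power2_eq_square algebra_simps)
  ultimately have "h * infnorm \<xi> \<le> (f x - f x') / L + 3 * h * infnorm w / L + h\<^sup>2 / 2"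
    by (simp add: power2_norm_eq_inner diff_divide_distrib)
  then have "L / h * (h * infnorm \<xi>) \<le> L / h * ((f x - f x') / L + 3 * h * infnorm w / L + h\<^sup>2 / 2)"
    using \<open>0 < L\<close> h by (intro mult_left_mono) auto
  moreover have "L / h * (h * infnorm \<xi>) = L * infnorm \<xi>" using h by simp
  moreover have "L / h * ((f x - f x') / L + 3 * h * infnorm w / L + h\<^sup>2 / 2)
      = L / e * (f x - f x') + 3 * infnorm w + e / 2"
    using \<open>0 < L\<close> h by (simp add: field_simps power2_eq_square)
  ultimately have bound_\<xi>: "L * infnorm \<xi> \<le> L / e * (f x - f x') + 3 * infnorm w + e / 2"
    by simp

  \<comment> \<open>the element of the subdifferential provided by the variational inequality, rescaled by \<open>L\<close>\<close>
  define v where "v = grad f x' - G - L *\<^sub>R (s + \<xi> + \<Gamma>)"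
  have "v \<in> constrained_subdiff f X x'"
  proof -
    define n where "n = - (L *\<^sub>R (s + (1 / L) *\<^sub>R G + \<xi> + \<Gamma>))"
    have "n \<in> normal_cone X x'"
      using vi \<open>0 < L\<close> x' unfolding normal_cone_def n_def by simp
    moreover have "v = grad f x' + n" using \<open>0 < L\<close> by (simp add: v_def n_def algebra_simps)
    ultimately show ?thesis by (auto simp: constrained_subdiff_def)
  qed
  moreover have "infnorm v \<le> 3 * e + infnorm w + 3 * e + L * infnorm \<xi> + e"
  proof -
    have tri: "infnorm (a - b) \<le> infnorm a + infnorm b" for a b :: "real ^ 'n"
      using infnorm_triangle[of a "- b"] by (simp add: infnorm_neg)
    have "v = ((((grad f x' - grad f x) - w) - L *\<^sub>R s) - L *\<^sub>R \<xi>) - L *\<^sub>R \<Gamma>"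
      by (simp add: v_def w_def algebra_simps)
    then have "infnorm v \<le> infnorm (grad f x' - grad f x) + infnorm w + infnorm (L *\<^sub>R s)
                 + infnorm (L *\<^sub>R \<xi>) + infnorm (L *\<^sub>R \<Gamma>)"
      by (auto intro!: order_trans[OF tri] add_right_mono)
    moreover have "infnorm (grad f x' - grad f x) \<le> L * norm s"
      using lip[OF x' \<open>x \<in> X\<close>] infnorm_le_norm[of "grad f x' - grad f x"] by (simp add: s_def)
    moreover have "infnorm (L *\<^sub>R s) \<le> L * norm s" "infnorm (L *\<^sub>R \<Gamma>) \<le> L * norm \<Gamma>"
      using \<open>0 < L\<close> by (simp_all add: infnorm_mul infnorm_le_norm)
    moreover have "L * norm s \<le> 3 * e" "L * norm \<Gamma> \<le> e"
      using s2 \<Gamma> \<open>0 < L\<close> h by simp_all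
    moreover have "infnorm (L *\<^sub>R \<xi>) = L * infnorm \<xi>"
      using \<open>0 < L\<close> by (simp add: infnorm_mul)
    ultimately show ?thesis by linarith
  qed
  ultimately show ?thesis
    using infdist0_le[of v "constrained_subdiff f X x'"] bound_\<xi> by (simp add: w_def)
qed

section \<open>Lower semicontinuity of the distance to the subdifferential\<close>

text \<open>
  The slack \<open>1 / Suc k\<close> makes up for the infimum, which need not be attained for a general \<open>S\<close>.
\<close>

lemma infdist0_le_iff:
  assumes "S \<noteq> {}"
  shows "infdist0 S \<le> a \<longleftrightarrow> (\<forall>k. \<exists>v\<in>S. infnorm v \<le> a + 1 / real (Suc k))"
proof
  assume "infdist0 S \<le> a"
  then have "(INF v\<in>S. infnorm v) < a + 1 / real (Suc k)" for k
    unfolding infdist0_def by (rule le_less_trans) simp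
  then show "\<forall>k. \<exists>v\<in>S. infnorm v \<le> a + 1 / real (Suc k)"
    using cInf_lessD[of "infnorm ` S"] assms by (blast intro: less_imp_le)
next
  assume *: "\<forall>k. \<exists>v\<in>S. infnorm v \<le> a + 1 / real (Suc k)"
  have "infdist0 S \<le> a + 1 / real (Suc k)" for k
    using * by (blast intro: order_trans[OF infdist0_le])
  moreover have "(\<lambda>k. a + 1 / real (Suc k)) \<longlonglongrightarrow> a + 0"
    by (intro tendsto_intros LIMSEQ_Suc[OF lim_1_over_n])
  ultimately show "infdist0 S \<le> a"
    by (intro LIMSEQ_le_const[where X="\<lambda>k. a + 1 / real (Suc k)"]) auto
qed

lemma compact_infnorm_ball: "compact {v :: real ^ 'n. infnorm v \<le> b}"
proof -
  have "bounded {v :: real ^ 'n. infnorm v \<le> b}"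
    by (rule boundedI[of _ "sqrt DIM(real ^ 'n) * b"])
       (auto intro!: order_trans[OF norm_le_infnorm] mult_left_mono)
  moreover have "closed {v :: real ^ 'n. infnorm v \<le> b}"
    by (intro closed_Collect_le continuous_intros)
  ultimately show ?thesis by (simp add: compact_eq_bounded_closed)
qed

text \<open>
  The pairs \<open>(v, x)\<close> with \<open>v\<close> in the subdifferential at \<open>x\<close> form a closed set, and restricting \<open>v\<close>
  to a compact ball makes the projection to \<open>x\<close> closed. The sublevel set is an intersection of such
  projections.
\<close>

lemma closed_infdist0_constrained_subdiff_le:
  fixes f :: "real ^ 'n \<Rightarrow> real"
  assumes "closed X" and cont: "continuous_on X (grad f)"
  shows "closed {x \<in> X. infdist0 (constrained_subdiff f X x) \<le> a}"
proof -
  define R where "R = {p \<in> UNIV \<times> X. \<forall>y\<in>X. (fst p - grad f (snd p)) \<bullet> (y - snd p) \<le> 0}"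
  have cont': "continuous_on (UNIV \<times> X) (\<lambda>p. grad f (snd p))"
    by (rule continuous_on_compose2[OF cont continuous_on_snd]) auto
  have "closed ((UNIV \<times> X) \<inter> (\<lambda>p. (fst p - grad f (snd p)) \<bullet> (y - snd p)) -` {..0})" for y
    using \<open>closed X\<close>
    by (intro continuous_closed_preimage continuous_intros cont' closed_Times) auto
  then have "closed {p \<in> UNIV \<times> X. (fst p - grad f (snd p)) \<bullet> (y - snd p) \<le> 0}" for y
    by (simp add: vimage_def Int_def)
  then have "closed ((UNIV \<times> X) \<inter> (\<Inter>y\<in>X. {p \<in> UNIV \<times> X. (fst p - grad f (snd p)) \<bullet> (y - snd p) \<le> 0}))"
    using \<open>closed X\<close> by (intro closed_Int closed_INT closed_Times ballI) auto
  also have "\<dots> = R" by (auto simp: R_def)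
  finally have "closed R" .
  have R: "(v, x) \<in> R \<longleftrightarrow> x \<in> X \<and> v \<in> constrained_subdiff f X x" for v x
    unfolding R_def constrained_subdiff_def normal_cone_def
    by (auto intro!: exI[of _ "v - grad f x"])
  have "x \<in> X \<and> infdist0 (constrained_subdiff f X x) \<le> a \<longleftrightarrow>
        (\<forall>k. \<exists>v. v \<in> {v. infnorm v \<le> a + 1 / real (Suc k)} \<and> (v, x) \<in> R)" for x
    unfolding R mem_Collect_eq
    by (cases "x \<in> X") (simp_all add: infdist0_le_iff[OF constrained_subdiff_nonempty] Bex_def conj_commute)
  then have "{x \<in> X. infdist0 (constrained_subdiff f X x) \<le> a} =
        (\<Inter>k. {x. \<exists>v. v \<in> {v. infnorm v \<le> a + 1 / real (Suc k)} \<and> (v, x) \<in> R})"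
    by blast
  also have "closed \<dots>"
    by (intro closed_INT ballI closed_compact_projection[OF compact_infnorm_ball \<open>closed R\<close>])
  finally show ?thesis .
qed

section \<open>Independence across value types\<close>

lemma (in prob_space) indep_vars_reindex:
  assumes inj: "inj_on h J" and indep: "indep_vars N X (h ` J)"
  shows "indep_vars (\<lambda>j. N (h j)) (\<lambda>j. X (h j)) J"
proof -
  let ?S = "\<lambda>i. {X i -` A \<inter> space M | A. A \<in> sets (N i)}"
  have "indep_sets (\<lambda>j. ?S (h j)) J"
  proof (rule indep_setsI)
    fix j assume "j \<in> J"
    then show "?S (h j) \<subseteq> events"
      using indep unfolding indep_vars_def2 by (auto intro: measurable_sets)
  next
    fix A J' assume J': "J' \<noteq> {}" "J' \<subseteq> J" "finite J'" and A: "\<forall>j\<in>J'. A j \<in> ?S (h j)"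
    define B where "B i = A (the_inv_into J' h i)" for i
    have inj': "inj_on h J'" using inj J'(2) by (rule inj_on_subset)
    have B: "B (h j) = A j" if "j \<in> J'" for j
      using the_inv_into_f_f[OF inj' that] by (simp add: B_def)
    have "prob (\<Inter>i\<in>h ` J'. B i) = (\<Prod>i\<in>h ` J'. prob (B i))"
      using indep J' A B unfolding indep_vars_def2
      by (intro indep_setsD[of ?S "h ` J"]) auto
    then show "prob (\<Inter>j\<in>J'. A j) = (\<Prod>j\<in>J'. prob (A j))"
      by (simp add: prod.reindex[OF inj'] B cong: INF_cong prod.cong)
  qed
  then show ?thesis
    using indep unfolding indep_vars_def2 by auto
qed

text \<open>
  The relation \<open>indep_var\<close> needs both variables to have the same value type. Independence of iterates,
  samples and the index is therefore handled through generated sigma-algebras, and these shrink when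
  a variable is replaced by a function of it.
\<close>

lemma sets_vimage_algebra_coarser:
  assumes W: "W \<in> M \<rightarrow>\<^sub>M S" and h: "h \<in> S \<rightarrow>\<^sub>M N"
  shows "sets (vimage_algebra (space M) (\<lambda>\<omega>. h (W \<omega>)) N) \<subseteq> sets (vimage_algebra (space M) W S)"
proof
  fix B assume "B \<in> sets (vimage_algebra (space M) (\<lambda>\<omega>. h (W \<omega>)) N)"
  then obtain A where A: "A \<in> sets N" "B = (\<lambda>\<omega>. h (W \<omega>)) -` A \<inter> space M"
    using measurable_space[OF measurable_compose[OF W h]] by (auto simp: sets_vimage_algebra2)
  then have "B = W -` (h -` A \<inter> space S) \<inter> space M"
    using measurable_space[OF W] by auto
  then show "B \<in> sets (vimage_algebra (space M) W S)"
    using in_vimage_algebra[OF measurable_sets[OF h A(1)]] by simp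
qed

lemma (in prob_space) indep_var_compose_indep_set:
  assumes U: "random_variable S U" and V: "random_variable T V"
    and indep: "indep_set (sets (vimage_algebra (space M) U S)) (sets (vimage_algebra (space M) V T))"
    and p: "p \<in> S \<rightarrow>\<^sub>M N" and q: "q \<in> T \<rightarrow>\<^sub>M N'"
  shows "indep_var N (\<lambda>\<omega>. p (U \<omega>)) N' (\<lambda>\<omega>. q (V \<omega>))"
proof -
  have "indep_set (sets (vimage_algebra (space M) (\<lambda>\<omega>. p (U \<omega>)) N))
                  (sets (vimage_algebra (space M) (\<lambda>\<omega>. q (V \<omega>)) N'))"
    using indep sets_vimage_algebra_coarser[OF U p] sets_vimage_algebra_coarser[OF V q] unfolding indep_sets2_eq by blast
  then show ?thesis
    using measurable_compose[OF U p] measurable_compose[OF V q]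
    by (simp add: indep_var_eq sets_vimage_algebra)
qed

lemma (in prob_space) joint_law_of_indep_set:
  assumes U: "random_variable S U" and V: "random_variable T V"
    and indep: "indep_set (sets (vimage_algebra (space M) U S)) (sets (vimage_algebra (space M) V T))"
  shows "distr M S U \<Otimes>\<^sub>M distr M T V = distr M (S \<Otimes>\<^sub>M T) (\<lambda>\<omega>. (U \<omega>, V \<omega>))"
proof (rule pair_measure_eqI)
  show "sigma_finite_measure (distr M S U)" "sigma_finite_measure (distr M T V)"
    using U V by (auto intro!: prob_space_imp_sigma_finite prob_space_distr)
  show "sets (distr M S U \<Otimes>\<^sub>M distr M T V) = sets (distr M (S \<Otimes>\<^sub>M T) (\<lambda>\<omega>. (U \<omega>, V \<omega>)))"
    by (simp cong: sets_pair_measure_cong)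
next
  fix A B assume "A \<in> sets (distr M S U)" "B \<in> sets (distr M T V)"
  then have A: "A \<in> sets S" and B: "B \<in> sets T" by simp_all
  have "prob (U -` A \<inter> space M \<inter> (V -` B \<inter> space M))
      = prob (U -` A \<inter> space M) * prob (V -` B \<inter> space M)"
    using A B by (intro indep_setD[OF indep] in_vimage_algebra)
  moreover have "(\<lambda>\<omega>. (U \<omega>, V \<omega>)) -` (A \<times> B) \<inter> space M = U -` A \<inter> space M \<inter> (V -` B \<inter> space M)"
    by auto
  ultimately show "emeasure (distr M S U) A * emeasure (distr M T V) B
      = emeasure (distr M (S \<Otimes>\<^sub>M T) (\<lambda>\<omega>. (U \<omega>, V \<omega>))) (A \<times> B)"
    using A B U V by (simp add: emeasure_distr emeasure_eq_measure ennreal_mult measurable_Pair)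
qed

text \<open>
  The random selection is the sum over \<open>k\<close> of \<open>g k\<close> times the indicator of \<open>Y = k\<close>, and each
  product has expectation \<open>1 / K\<close> times that of \<open>g k\<close>.
\<close>

lemma (in prob_space) random_index_expectation:
  fixes g :: "nat \<Rightarrow> 'a \<Rightarrow> real" and Y :: "'a \<Rightarrow> nat"
  assumes Y_meas: "Y \<in> M \<rightarrow>\<^sub>M count_space {1..K}"
    and Y: "distr M (count_space {1..K}) Y = uniform_count_measure {1..K}"
    and indep: "\<And>k. k \<in> {1..K} \<Longrightarrow> indep_var borel (\<lambda>\<omega>. indicat_real {k} (Y \<omega>)) borel (g k)"
    and int: "\<And>k. k \<in> {1..K} \<Longrightarrow> integrable M (g k)"
  shows "integrable M (\<lambda>\<omega>. g (Y \<omega>) \<omega>)"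
    and "expectation (\<lambda>\<omega>. g (Y \<omega>) \<omega>) = (\<Sum>k=1..K. expectation (g k)) / real K"
proof -
  define I where "I k \<omega> = indicat_real {k} (Y \<omega>)" for k \<omega>
  have prob_Y: "prob {\<omega> \<in> space M. Y \<omega> = k} = 1 / real K" if "k \<in> {1..K}" for k
  proof -
    have "prob (Y -` {k} \<inter> space M) = measure (distr M (count_space {1..K}) Y) {k}"
      using that by (intro measure_distr[symmetric] Y_meas) auto
    also have "\<dots> = 1 / real K"
      using that unfolding Y by (subst measure_uniform_count_measure) auto
    finally show ?thesis by (simp add: vimage_def Int_def conj_commute)
  qed
  have I: "integrable M (I k)" "expectation (I k) = 1 / real K"
    "indep_var borel (I k) borel (g k)" if k: "k \<in> {1..K}" for k
  proof -
    have meas: "{\<omega> \<in> space M. Y \<omega> = k} \<in> sets M"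
      using measurable_sets[OF Y_meas, of "{k}"] k by (simp add: vimage_def Int_def conj_commute)
    have I_eq: "I k \<omega> = indicat_real {\<omega> \<in> space M. Y \<omega> = k} \<omega>" if "\<omega> \<in> space M" for \<omega>
      using that by (simp add: I_def indicator_def)
    show "integrable M (I k)"
      using meas by (subst Bochner_Integration.integrable_cong[OF refl I_eq]) (auto simp: emeasure_eq_measure)
    show "expectation (I k) = 1 / real K"
      using meas prob_Y[OF k] by (subst Bochner_Integration.integral_cong[OF refl I_eq]) auto
    show "indep_var borel (I k) borel (g k)"
      using indep[OF k] by (simp add: I_def[abs_def])
  qed
  have split: "g (Y \<omega>) \<omega> = (\<Sum>k=1..K. I k \<omega> * g k \<omega>)" if "\<omega> \<in> space M" for \<omega>
  proof -
    have "Y \<omega> \<in> {1..K}" using measurable_space[OF Y_meas that] by simp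
    then have "(\<Sum>k=1..K. I k \<omega> * g k \<omega>) = (\<Sum>k=1..K. if k = Y \<omega> then g k \<omega> else 0)"
      by (intro sum.cong) (auto simp: I_def indicator_def)
    with \<open>Y \<omega> \<in> {1..K}\<close> show ?thesis by simp
  qed
  have term_int: "integrable M (\<lambda>\<omega>. I k \<omega> * g k \<omega>)" if "k \<in> {1..K}" for k
    using indep_var_integrable[OF I(3) I(1) int] that by simp
  have term_eq: "expectation (\<lambda>\<omega>. I k \<omega> * g k \<omega>) = expectation (g k) / real K" if "k \<in> {1..K}" for k
    using indep_var_lebesgue_integral[OF I(3) I(1) int] I(2) that by simp
  show "integrable M (\<lambda>\<omega>. g (Y \<omega>) \<omega>)"
    using term_int by (subst Bochner_Integration.integrable_cong[OF refl split]) auto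
  show "expectation (\<lambda>\<omega>. g (Y \<omega>) \<omega>) = (\<Sum>k=1..K. expectation (g k)) / real K"
    using term_int term_eq
    by (subst Bochner_Integration.integral_cong[OF refl split])
       (auto simp: Bochner_Integration.integral_sum sum_divide_distrib)
qed

section \<open>Smoothness of the objective and noise at a fixed point\<close>

lemma borel_measurable_nth: "(\<lambda>v :: real ^ 'n. v $ i) \<in> borel_measurable borel"
  by (intro borel_measurable_continuous_onI continuous_intros)

lemma measurable_minibatch_grad:
  fixes F :: "real ^ 'n \<Rightarrow> 'z \<Rightarrow> real"
  assumes [measurable]: "(\<lambda>(x, z). grad (\<lambda>u. F u z) x) \<in> borel_measurable (borel \<Otimes>\<^sub>M N)"
  shows "(\<lambda>(z, x). minibatch_grad F m z x) \<in> borel_measurable (PiM {1..m} (\<lambda>_. N) \<Otimes>\<^sub>M borel)"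
proof -
  have "(\<lambda>p. grad (\<lambda>u. F u (fst p i)) (snd p)) \<in> borel_measurable (PiM {1..m} (\<lambda>_. N) \<Otimes>\<^sub>M borel)"
    if i: "i \<in> {1..m}" for i
  proof -
    have "(\<lambda>p. (snd p, fst p i)) \<in> (PiM {1..m} (\<lambda>_. N) \<Otimes>\<^sub>M borel) \<rightarrow>\<^sub>M (borel \<Otimes>\<^sub>M N)"
      using i by measurable
    from measurable_compose[OF this assms] show ?thesis by simp
  qed
  then show ?thesis
    unfolding minibatch_grad_def case_prod_beta by measurable
qed

context stochastic_problem
begin

abbreviation f :: "real ^ 'n \<Rightarrow> real" where
  "f \<equiv> objective M \<zeta> F"

abbreviation R :: "'z measure" where
  "R \<equiv> restrict_space borel \<Xi>"

lemma zeta_in_Xi: "\<omega> \<in> space M \<Longrightarrow> \<zeta> \<omega> \<in> \<Xi>"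
  using measurable_space[OF zeta_measurable] by (simp add: space_restrict_space)

lemma grad_F_measurable: "(\<lambda>(x, z). grad (\<lambda>u. F u z) x) \<in> borel_measurable (borel \<Otimes>\<^sub>M R)"
  using F_differentiable by (intro grad_measurable F_measurable) (simp add: space_restrict_space)

lemma grad_F_section_measurable: "(\<lambda>z. grad (\<lambda>u. F u z) x) \<in> borel_measurable R"
  using measurable_compose[OF measurable_Pair1' grad_F_measurable, of x] by simp

lemma continuous_f: "continuous_on UNIV f"
  using f_differentiable by (intro continuous_at_imp_continuous_on ballI differentiable_imp_continuous_within)

lemma grad_f_measurable: "grad f \<in> borel_measurable borel"
  using measurable_compose[OF measurable_Pair2' grad_measurable[where N="count_space {()}" and g="\<lambda>x _. f x"], of "()"]
    f_differentiable by simp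

lemma grad_f_eq_expectation:
  assumes "x \<in> X"
  shows "has_bochner_integral M (\<lambda>\<omega>. grad (\<lambda>u. F u (\<zeta> \<omega>)) x) (grad f x)"
proof -
  have "has_bochner_integral M (\<lambda>\<omega>. grad f x) (grad f x)"
    by (simp add: has_bochner_integral_iff prob_space)
  from has_bochner_integral_add[OF noise_mean[OF assms] this] show ?thesis by simp
qed

text \<open>
  On \<open>X\<close> the noise is centred, so that the gradient of \<open>f\<close> is the expectation of the stochastic
  gradient and inherits its Lipschitz constant.
\<close>

lemma grad_f_lipschitz:
  assumes x: "x \<in> X" and y: "y \<in> X"
  shows "norm (grad f x - grad f y) \<le> L * norm (x - y)"
proof -
  let ?D = "\<lambda>\<omega>. grad (\<lambda>u. F u (\<zeta> \<omega>)) x - grad (\<lambda>u. F u (\<zeta> \<omega>)) y"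
  have D: "has_bochner_integral M ?D (grad f x - grad f y)"
    by (intro has_bochner_integral_diff grad_f_eq_expectation assms)
  then have "norm (grad f x - grad f y) \<le> expectation (\<lambda>\<omega>. norm (?D \<omega>))"
    using integral_norm_bound[of M ?D] by (simp add: has_bochner_integral_iff)
  also have "\<dots> \<le> L * norm (x - y)"
    using D grad_lipschitz[OF assms zeta_in_Xi]
    by (intro integral_le_const) (auto simp: has_bochner_integral_iff)
  finally show ?thesis .
qed

text \<open>
  Numbering the coordinates by \<open>b\<close> turns the noise at \<open>x\<close> into a point \<open>T z\<close> of the product space over
  \<open>{..<CARD('n)}\<close>. Its law \<open>\<mu>\<close> is centred and sub-Gaussian, and independence makes the joint law of the
  \<open>m\<close> noise vectors the \<open>m\<close>-fold product of \<open>\<mu>\<close>, which is the situation of \<open>maximal_const\<close>.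
\<close>

lemma minibatch_noise_at_fixed_point:
  assumes c: "maximal_const c" and m: "1 \<le> m" and x: "x \<in> X"
    and indep: "indep_vars (\<lambda>_. R) W {1..m}"
    and law: "\<And>i. i \<in> {1..m} \<Longrightarrow> distr M R (W i) = distr M R \<zeta>"
  shows "(\<integral>\<^sup>+\<omega>. ennreal ((infnorm (minibatch_grad F m (\<lambda>i. W i \<omega>) x - grad f x))\<^sup>2) \<partial>M)
           \<le> ennreal (c * ln (real CARD('n)) * \<sigma>\<^sup>2 / real m)"
proof -
  let ?d = "CARD('n)" and ?P = "PiM {..<CARD('n)} (\<lambda>_. borel :: real measure)"
  obtain b where b: "bij_betw b {..<?d} (UNIV :: 'n set)"
    using ex_bij_betw_nat_finite[of "UNIV :: 'n set"] by (auto simp: atLeast0LessThan)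
  define T where "T z = (\<lambda>i\<in>{..<?d}. (grad (\<lambda>u. F u z) x - grad f x) $ b i)" for z
  have T[measurable]: "T \<in> R \<rightarrow>\<^sub>M ?P"
    unfolding T_def using grad_F_section_measurable
    by (intro measurable_restrict measurable_compose[OF _ borel_measurable_nth] borel_measurable_diff) auto
  define \<mu> where "\<mu> = distr M ?P (\<lambda>\<omega>. T (\<zeta> \<omega>))"
  note [measurable] = zeta_measurable
  have T\<zeta>: "(\<lambda>\<omega>. T (\<zeta> \<omega>)) \<in> M \<rightarrow>\<^sub>M ?P" by measurable
  have \<mu>: "prob_space \<mu>" "sets \<mu> = sets ?P"
    unfolding \<mu>_def by (auto intro!: prob_space_distr)
  have mean: "has_bochner_integral \<mu> (\<lambda>w. w i) 0" if "i < ?d" for i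
  proof -
    have "has_bochner_integral M (\<lambda>\<omega>. (grad (\<lambda>u. F u (\<zeta> \<omega>)) x - grad f x) $ b i) (0 $ b i)"
      by (rule has_bochner_integral_bounded_linear[OF bounded_linear_vec_nth noise_mean[OF x]])
    then show ?thesis
      using that T\<zeta> unfolding \<mu>_def by (subst has_bochner_integral_distr) (auto simp: T_def)
  qed
  have subg: "subgaussian \<mu> \<sigma> (\<lambda>w. w i)" if "i < ?d" for i
  proof -
    have meas: "(\<lambda>w. exp (t * w i)) \<in> borel_measurable ?P" for t
    proof (rule measurable_compose[where f="\<lambda>w. w i"])
      show "(\<lambda>w. w i) \<in> borel_measurable ?P"
        using that by (intro measurable_component_singleton) simp
    qed measurable
    show ?thesis
      using noise_subgaussian[OF x, of "b i"] that unfolding \<mu>_def subgaussian_def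
      by (simp add: integrable_distr_eq[OF T\<zeta> meas] integral_distr[OF T\<zeta> meas]) (simp add: T_def)
  qed

  have m_nonempty: "{..<m} \<noteq> {}" using m by (auto simp: lessThan_empty_iff)
  define V where "V j \<omega> = T (W (Suc j) \<omega>)" for j \<omega>
  have W_meas: "W i \<in> M \<rightarrow>\<^sub>M R" if "i \<in> {1..m}" for i
    using indep that by (auto simp: indep_vars_def)
  have V_meas: "V j \<in> M \<rightarrow>\<^sub>M ?P" if "j < m" for j
    unfolding V_def using W_meas[of "Suc j"] that by (intro measurable_compose[OF _ T]) auto
  have "indep_vars (\<lambda>_. R) (\<lambda>j. W (Suc j)) {..<m}"
    using indep indep_vars_reindex[of Suc "{..<m}" "\<lambda>_. R" W] by (simp add: image_Suc_lessThan)
  then have "indep_vars (\<lambda>_. ?P) V {..<m}"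
    unfolding V_def by (rule indep_vars_compose2) (rule T)
  moreover have "distr M ?P (V j) = \<mu>" if "j < m" for j
  proof -
    have "distr M ?P (V j) = distr (distr M R (W (Suc j))) ?P T"
      unfolding V_def using that W_meas[of "Suc j"] by (subst distr_distr) (auto simp: comp_def)
    also have "\<dots> = distr (distr M R \<zeta>) ?P T" using that law[of "Suc j"] by simp
    also have "\<dots> = \<mu>" unfolding \<mu>_def by (subst distr_distr) (auto simp: comp_def)
    finally show ?thesis .
  qed
  ultimately have joint: "distr M (PiM {..<m} (\<lambda>_. ?P)) (\<lambda>\<omega>. \<lambda>j\<in>{..<m}. V j \<omega>) = PiM {..<m} (\<lambda>_. \<mu>)"
    using m_nonempty V_meas
    by (subst indep_vars_iff_distr_eq_PiM'[THEN iffD1]) (auto intro!: PiM_cong)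

  let ?max = "\<lambda>U :: nat \<Rightarrow> nat \<Rightarrow> real. MAX i\<in>{..<?d}. \<bar>(\<Sum>j<m. U j i) / real m\<bar>"
  have entry: "(\<lambda>U. U j i) \<in> borel_measurable (PiM {..<m} (\<lambda>_. ?P))" if "j < m" "i < ?d" for j i
  proof (rule measurable_compose[where f="\<lambda>U. U j"])
    show "(\<lambda>U. U j) \<in> PiM {..<m} (\<lambda>_. ?P) \<rightarrow>\<^sub>M ?P" "(\<lambda>w. w i) \<in> borel_measurable ?P"
      using that by (intro measurable_component_singleton; simp)+
  qed
  then have "?max \<in> borel_measurable (PiM {..<m} (\<lambda>_. ?P))"
    by (intro borel_measurable_Max borel_measurable_abs borel_measurable_divide borel_measurable_sum) auto
  then have max_meas: "(\<lambda>U. (?max U)\<^sup>2) \<in> borel_measurable (PiM {..<m} (\<lambda>_. ?P))"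
    by (rule borel_measurable_power)
  have "infnorm (minibatch_grad F m (\<lambda>i. W i \<omega>) x - grad f x) \<le> ?max (\<lambda>j\<in>{..<m}. V j \<omega>)" for \<omega>
  proof -
    let ?w = "minibatch_grad F m (\<lambda>i. W i \<omega>) x - grad f x"
    obtain l where l: "infnorm ?w = \<bar>?w $ l\<bar>" by (rule infnorm_attained)
    obtain i where i: "i < ?d" "l = b i" using b by (metis UNIV_I bij_betw_def imageE lessThan_iff)
    have "?w $ l = (\<Sum>j<m. grad (\<lambda>u. F u (W (Suc j) \<omega>)) x $ l) / real m - grad f x $ l"
      by (simp add: minibatch_grad_def sum.atLeast1_atMost_eq)
    also have "\<dots> = (\<Sum>j<m. (grad (\<lambda>u. F u (W (Suc j) \<omega>)) x - grad f x) $ l) / real m"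
      using m by (simp add: sum_subtractf diff_divide_distrib)
    also have "\<dots> = (\<Sum>j<m. (\<lambda>j\<in>{..<m}. V j \<omega>) j i) / real m"
      using i by (simp add: V_def T_def)
    finally have "infnorm ?w = \<bar>(\<Sum>j<m. (\<lambda>j\<in>{..<m}. V j \<omega>) j i) / real m\<bar>"
      using l by simp
    then show ?thesis using i(1) by (intro Max_ge) auto
  qed
  then have "(\<integral>\<^sup>+\<omega>. ennreal ((infnorm (minibatch_grad F m (\<lambda>i. W i \<omega>) x - grad f x))\<^sup>2) \<partial>M)
      \<le> (\<integral>\<^sup>+\<omega>. ennreal ((?max (\<lambda>j\<in>{..<m}. V j \<omega>))\<^sup>2) \<partial>M)"
    by (intro nn_integral_mono ennreal_leI power_mono infnorm_pos_le)
  also have "\<dots> = (\<integral>\<^sup>+U. ennreal ((?max U)\<^sup>2) \<partial>PiM {..<m} (\<lambda>_. \<mu>))"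
    unfolding joint[symmetric] using V_meas max_meas
    by (subst nn_integral_distr) (auto intro!: measurable_restrict measurable_compose[OF _ measurable_ennreal])
  also have "\<dots> \<le> ennreal (c * ln (real ?d) * \<sigma>\<^sup>2 / real m)"
    using c dim_ge_2 m sigma_pos \<mu> mean subg unfolding maximal_const_def by blast
  finally show ?thesis .
qed

end

section \<open>Sample complexity\<close>

text \<open>
  Once \<open>e\<^sup>2 \<le> min a b\<close>, rounding up at most doubles each of the two factors.
\<close>

lemma eventually_sample_complexity:
  fixes a b :: real
  assumes "0 < a" "0 < b"
  shows "\<forall>\<^sub>F e in at_right 0. real (nat \<lceil>a / e\<^sup>2\<rceil> * nat \<lceil>b / e\<^sup>2\<rceil>) \<le> 4 * (a * b / e ^ 4)"
proof -
  have nat_ceiling_le: "real (nat \<lceil>t\<rceil>) \<le> 2 * t" if "1 \<le> t" for t :: real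
    using that by linarith
  have "\<forall>\<^sub>F e in at_right 0. e \<in> {0 <..< min (sqrt a) (sqrt b)}"
    using assms by (intro eventually_at_right_real) auto
  then show ?thesis
  proof eventually_elim
    case (elim e)
    then have "e\<^sup>2 \<le> (sqrt a)\<^sup>2" "e\<^sup>2 \<le> (sqrt b)\<^sup>2" by (intro power_mono; simp)+
    then have "1 \<le> a / e\<^sup>2" "1 \<le> b / e\<^sup>2" using assms elim by auto
    then have "real (nat \<lceil>a / e\<^sup>2\<rceil>) * real (nat \<lceil>b / e\<^sup>2\<rceil>) \<le> (2 * (a / e\<^sup>2)) * (2 * (b / e\<^sup>2))"
      by (intro mult_mono nat_ceiling_le) auto
    then show ?case by (simp add: field_simps flip: power_add)
  qed
qed

section \<open>Noise along the run\<close>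

context disfom_run
begin

lemma iterate_in_X:
  assumes "k \<in> {1..Suc K}" "\<omega> \<in> space M"
  shows "x k \<omega> \<in> X"
proof (cases "k = 1")
  case True
  then show ?thesis using x1_in_X assms by simp
next
  case False
  with assms(1) obtain j where "k = Suc j" "j \<in> {1..K}" by (cases k) auto
  then show ?thesis using step[of j \<omega>] assms(2) by (simp add: disfom_step_def)
qed

definition noise :: "nat \<Rightarrow> 'w \<Rightarrow> real" where
  "noise k \<omega> = infnorm (minibatch_grad F m (\<lambda>i. Z k i \<omega>) (x k \<omega>) - grad f (x k \<omega>))"

lemma sample_measurable:
  assumes "k \<in> {1..K}" "i \<in> {1..m}"
  shows "Z k i \<in> M \<rightarrow>\<^sub>M R"
  using samples_indep assms by (auto simp: indep_vars_def)

lemma samples_measurable: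
  assumes "k \<in> {1..K}"
  shows "(\<lambda>\<omega>. \<lambda>i\<in>{1..m}. Z k i \<omega>) \<in> M \<rightarrow>\<^sub>M PiM {1..m} (\<lambda>_. R)"
  using sample_measurable[OF assms] by (intro measurable_restrict)

lemma minibatch_grad_restrict:
  "minibatch_grad F m (\<lambda>i\<in>{Suc 0..m}. z i) u = minibatch_grad F m z u"
  by (simp add: minibatch_grad_def)

lemma infnorm_measurable: "(infnorm :: real ^ 'n \<Rightarrow> real) \<in> borel_measurable borel"
  by (intro borel_measurable_continuous_onI continuous_intros)

lemma noise_kernel_measurable:
  "(\<lambda>(z, u). infnorm (minibatch_grad F m z u - grad f u)) \<in> borel_measurable (PiM {1..m} (\<lambda>_. R) \<Otimes>\<^sub>M borel)"
proof -
  note [measurable] = grad_f_measurable infnorm_measurable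
  have "(\<lambda>p. minibatch_grad F m (fst p) (snd p)) \<in> borel_measurable (PiM {1..m} (\<lambda>_. R) \<Otimes>\<^sub>M borel)"
    using measurable_minibatch_grad[OF grad_F_measurable, of m] by (simp add: case_prod_beta)
  then show ?thesis by (simp add: case_prod_beta)
qed

lemma noise_measurable:
  assumes k: "k \<in> {1..K}"
  shows "noise k \<in> borel_measurable M"
proof -
  have "(\<lambda>\<omega>. (\<lambda>i\<in>{1..m}. Z k i \<omega>, x k \<omega>)) \<in> M \<rightarrow>\<^sub>M (PiM {1..m} (\<lambda>_. R) \<Otimes>\<^sub>M borel)"
    using k by (intro measurable_Pair samples_measurable x_measurable) auto
  from measurable_compose[OF this noise_kernel_measurable] show ?thesis
    by (simp add: minibatch_grad_restrict noise_def[abs_def])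
qed

text \<open>
  The current iterate and the minibatch have a product law, so the expectation is an iterated integral
  whose inner part has the iterate frozen at a point of \<open>X\<close>.
\<close>

lemma noise_second_moment:
  assumes c: "maximal_const c" and k: "k \<in> {1..K}"
  shows "(\<integral>\<^sup>+\<omega>. ennreal ((noise k \<omega>)\<^sup>2) \<partial>M) \<le> ennreal (c * ln (real CARD('n)) * \<sigma>\<^sup>2 / real m)"
proof -
  let ?S = "PiM {1..m} (\<lambda>_. R)"
  let ?Z = "\<lambda>\<omega>. \<lambda>i\<in>{1..m}. Z k i \<omega>"
  let ?h = "\<lambda>p. ennreal ((infnorm (minibatch_grad F m (fst p) (snd p) - grad f (snd p)))\<^sup>2)"
  have Z: "?Z \<in> M \<rightarrow>\<^sub>M ?S" by (rule samples_measurable[OF k])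
  have x: "x k \<in> borel_measurable M" using k by (intro x_measurable) auto
  have h: "?h \<in> borel_measurable (?S \<Otimes>\<^sub>M borel)"
    using noise_kernel_measurable by (simp add: case_prod_beta)
  interpret PS: prob_space "distr M ?S ?Z" by (rule prob_space_distr[OF Z])
  interpret PX: prob_space "distr M borel (x k)" by (rule prob_space_distr[OF x])
  interpret PP: pair_sigma_finite "distr M ?S ?Z" "distr M borel (x k)" ..
  have h_distr: "?h \<in> borel_measurable (distr M ?S ?Z \<Otimes>\<^sub>M distr M borel (x k))"
    using h by (subst measurable_cong_sets[OF sets_pair_measure_cong[OF sets_distr sets_distr] refl])
  have h_swap: "(\<lambda>(u, z). ?h (z, u)) \<in> borel_measurable (borel \<Otimes>\<^sub>M distr M ?S ?Z)"
    using measurable_pair_swap[OF h]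
    by (subst measurable_cong_sets[OF sets_pair_measure_cong[OF refl sets_distr] refl])
  let ?H = "\<lambda>\<omega>. \<lambda>j\<in>{1..k}. x j \<omega>"
  have H: "?H \<in> M \<rightarrow>\<^sub>M PiM {1..k} (\<lambda>_. borel)"
    using k by (intro measurable_restrict x_measurable) auto
  have "sets (vimage_algebra (space M) (x k) borel)
      \<subseteq> sets (vimage_algebra (space M) ?H (PiM {1..k} (\<lambda>_. borel)))"
    using sets_vimage_algebra_coarser[OF H measurable_component_singleton, of k] k by simp
  then have "indep_set (sets (vimage_algebra (space M) ?Z ?S)) (sets (vimage_algebra (space M) (x k) borel))"
    using samples_indep_past[OF k] unfolding indep_sets2_eq by blast
  from joint_law_of_indep_set[OF Z x this]
  have joint: "distr M ?S ?Z \<Otimes>\<^sub>M distr M borel (x k) = distr M (?S \<Otimes>\<^sub>M borel) (\<lambda>\<omega>. (?Z \<omega>, x k \<omega>))" .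

  have "(\<integral>\<^sup>+\<omega>. ennreal ((noise k \<omega>)\<^sup>2) \<partial>M) = (\<integral>\<^sup>+\<omega>. ?h (?Z \<omega>, x k \<omega>) \<partial>M)"
    by (simp add: noise_def minibatch_grad_restrict)
  also have "\<dots> = (\<integral>\<^sup>+p. ?h p \<partial>(distr M ?S ?Z \<Otimes>\<^sub>M distr M borel (x k)))"
    unfolding joint using h by (intro nn_integral_distr[symmetric] measurable_Pair Z x) simp
  also have "\<dots> = (\<integral>\<^sup>+u. \<integral>\<^sup>+z. ?h (z, u) \<partial>distr M ?S ?Z \<partial>distr M borel (x k))"
    by (rule PP.nn_integral_snd[OF h_distr, symmetric])
  also have "\<dots> = (\<integral>\<^sup>+\<omega>. \<integral>\<^sup>+z. ?h (z, x k \<omega>) \<partial>distr M ?S ?Z \<partial>M)"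
    by (rule nn_integral_distr[OF x]) (simp add: PS.borel_measurable_nn_integral[OF h_swap, simplified])
  also have "\<dots> \<le> (\<integral>\<^sup>+\<omega>. ennreal (c * ln (real CARD('n)) * \<sigma>\<^sup>2 / real m) \<partial>M)"
  proof (rule nn_integral_mono)
    fix \<omega> assume "\<omega> \<in> space M"
    then have u: "x k \<omega> \<in> X" using k by (intro iterate_in_X) auto
    \<comment> \<open>the samples of one iteration form a row of the independent array of all samples\<close>
    have "Pair k ` {1..m} \<subseteq> {1..K} \<times> {1..m}" using k by auto
    then have "indep_vars (\<lambda>_. R) (Z k) {1..m}"
      using indep_vars_reindex[OF _ indep_vars_subset[OF samples_indep], of "Pair k" "{1..m}"]
      by (simp add: inj_on_def)
    then have "(\<integral>\<^sup>+\<omega>'. ?h (?Z \<omega>', x k \<omega>) \<partial>M) \<le> ennreal (c * ln (real CARD('n)) * \<sigma>\<^sup>2 / real m)"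
      using minibatch_noise_at_fixed_point[OF c m_pos u, of "Z k"] samples_distr[OF k]
      by (simp add: minibatch_grad_restrict)
    moreover have "(\<integral>\<^sup>+z. ?h (z, x k \<omega>) \<partial>distr M ?S ?Z) = (\<integral>\<^sup>+\<omega>'. ?h (?Z \<omega>', x k \<omega>) \<partial>M)"
      using measurable_compose[OF measurable_Pair2' h, of "x k \<omega>"] by (intro nn_integral_distr Z) auto
    ultimately show "(\<integral>\<^sup>+z. ?h (z, x k \<omega>) \<partial>distr M ?S ?Z) \<le> ennreal (c * ln (real CARD('n)) * \<sigma>\<^sup>2 / real m)"
      by simp
  qed
  also have "\<dots> = ennreal (c * ln (real CARD('n)) * \<sigma>\<^sup>2 / real m)"
    by (simp add: emeasure_space_1)
  finally show ?thesis .
qed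

text \<open>
  The inequality \<open>t \<le> (t\<^sup>2 / e + e) / 2\<close> replaces the one of Jensen and gives integrability as well.
\<close>

lemma noise_first_moment:
  assumes c: "maximal_const c" and k: "k \<in> {1..K}" and "0 < e"
    and m: "c * ln (real CARD('n)) * \<sigma>\<^sup>2 / real m \<le> e\<^sup>2"
  shows "integrable M (noise k)" and "expectation (noise k) \<le> e"
proof -
  note [measurable] = noise_measurable[OF k]
  have square: "(\<integral>\<^sup>+\<omega>. ennreal ((noise k \<omega>)\<^sup>2) \<partial>M) \<le> ennreal (e\<^sup>2)"
    by (rule order_trans[OF noise_second_moment[OF c k] ennreal_leI[OF m]])
  have int: "integrable M (\<lambda>\<omega>. (noise k \<omega>)\<^sup>2)"
    using le_less_trans[OF square ennreal_less_top] by (intro integrableI_nonneg) simp_all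
  then have "expectation (\<lambda>\<omega>. (noise k \<omega>)\<^sup>2) \<le> e\<^sup>2"
    using square by (simp add: nn_integral_eq_integral)
  have le: "noise k \<omega> \<le> ((noise k \<omega>)\<^sup>2 / e + e) / 2" for \<omega>
    using zero_le_power2[of "noise k \<omega> - e"] \<open>0 < e\<close> by (simp add: field_simps power2_eq_square)
  have nonneg: "0 \<le> noise k \<omega>" for \<omega> by (simp add: noise_def infnorm_pos_le)
  show int_noise: "integrable M (noise k)"
  proof (rule Bochner_Integration.integrable_bound)
    show "integrable M (\<lambda>\<omega>. ((noise k \<omega>)\<^sup>2 / e + e) / 2)" using int by simp
    show "AE \<omega> in M. norm (noise k \<omega>) \<le> norm (((noise k \<omega>)\<^sup>2 / e + e) / 2)"
      using le nonneg by (intro AE_I2) (fastforce intro: order_trans[OF _ abs_ge_self])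
  qed (rule noise_measurable[OF k])
  have "expectation (noise k) \<le> expectation (\<lambda>\<omega>. ((noise k \<omega>)\<^sup>2 / e + e) / 2)"
    using int int_noise by (intro integral_mono le) simp_all
  also have "\<dots> = (expectation (\<lambda>\<omega>. (noise k \<omega>)\<^sup>2) / e + e) / 2"
    using int by (simp add: prob_space)
  also have "\<dots> \<le> (e\<^sup>2 / e + e) / 2"
    using \<open>expectation _ \<le> e\<^sup>2\<close> \<open>0 < e\<close> by (intro divide_right_mono add_right_mono) auto
  finally show "expectation (noise k) \<le> e" using \<open>0 < e\<close> by (simp add: power2_eq_square)
qed

section \<open>Averaging over the run\<close>

definition stationarity :: "nat \<Rightarrow> 'w \<Rightarrow> real" where
  "stationarity k \<omega> = infdist0 (constrained_subdiff f X (x k \<omega>))"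

lemma stationarity_nonneg:
  assumes "k \<in> {1..Suc K}" "\<omega> \<in> space M"
  shows "0 \<le> stationarity k \<omega>"
  unfolding stationarity_def
  by (intro infdist0_nonneg constrained_subdiff_nonempty iterate_in_X assms)

text \<open>
  The function is set to \<open>0\<close> outside \<open>X\<close>, where the subdifferential is empty, in order to have a Borel
  function on the whole space; iterates never leave \<open>X\<close>. Its sublevel sets inside \<open>X\<close> are closed.
\<close>

lemma stationarity_kernel_measurable:
  "(\<lambda>u. if u \<in> X then infdist0 (constrained_subdiff f X u) else 0) \<in> borel_measurable borel"
    (is "?G \<in> _")
proof (rule borel_measurable_iff_le[THEN iffD2], rule allI)
  fix a
  have "L-lipschitz_on X (grad f)"
    using grad_f_lipschitz L_pos by (intro lipschitz_onI) (auto simp: dist_norm)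
  then have "continuous_on X (grad f)" by (rule lipschitz_on_continuous_on)
  then have "closed {u \<in> X. infdist0 (constrained_subdiff f X u) \<le> a}"
    by (rule closed_infdist0_constrained_subdiff_le[OF X_closed])
  moreover have "{u \<in> space borel. ?G u \<le> a} =
      {u \<in> X. infdist0 (constrained_subdiff f X u) \<le> a} \<union> (if 0 \<le> a then - X else {})"
    by auto
  ultimately show "{u \<in> space borel. ?G u \<le> a} \<in> sets borel"
    using X_closed by (simp add: borel_closed borel_open open_Compl)
qed

lemma stationarity_eq_kernel:
  assumes "k \<in> {1..Suc K}" "\<omega> \<in> space M"
  shows "stationarity k \<omega>
    = (if x k \<omega> \<in> X then infdist0 (constrained_subdiff f X (x k \<omega>)) else 0)"
  using iterate_in_X[OF assms] by (simp add: stationarity_def)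

lemma stationarity_measurable:
  assumes "k \<in> {1..Suc K}"
  shows "stationarity k \<in> borel_measurable M"
  using measurable_compose[OF x_measurable[OF assms] stationarity_kernel_measurable]
  by (rule measurable_cong[THEN iffD2, rotated]) (rule stationarity_eq_kernel[OF assms])

lemma index_indep_stationarity:
  assumes k: "k \<in> {1..K}"
  shows "indep_var borel (\<lambda>\<omega>. indicat_real {k} (Y \<omega>)) borel
    (\<lambda>\<omega>. if x (Suc k) \<omega> \<in> X then infdist0 (constrained_subdiff f X (x (Suc k) \<omega>)) else 0)"
proof -
  let ?T = "PiM {1..Suc K} (\<lambda>_. borel :: (real ^ 'n) measure) \<Otimes>\<^sub>M PiM ({1..K} \<times> {1..m}) (\<lambda>_. R)"
  let ?V = "\<lambda>\<omega>. (\<lambda>k\<in>{1..Suc K}. x k \<omega>, \<lambda>p\<in>{1..K} \<times> {1..m}. Z (fst p) (snd p) \<omega>)"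
  let ?G = "\<lambda>u. if u \<in> X then infdist0 (constrained_subdiff f X u) else 0"
  have V: "?V \<in> M \<rightarrow>\<^sub>M ?T"
    by (intro measurable_Pair measurable_restrict x_measurable sample_measurable) auto
  have "(\<lambda>v. fst v (Suc k)) \<in> ?T \<rightarrow>\<^sub>M borel"
    using k by (intro measurable_compose[OF measurable_fst] measurable_component_singleton) auto
  then have "(\<lambda>v. ?G (fst v (Suc k))) \<in> borel_measurable ?T"
    by (rule measurable_compose[OF _ stationarity_kernel_measurable])
  then have "indep_var borel (\<lambda>\<omega>. indicat_real {k} (Y \<omega>)) borel (\<lambda>\<omega>. ?G (fst (?V \<omega>) (Suc k)))"
    by (intro indep_var_compose_indep_set[OF Y_measurable V Y_indep, where p="indicat_real {k}"
          and q="\<lambda>v. ?G (fst v (Suc k))"]) auto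
  moreover have "fst (?V \<omega>) (Suc k) = x (Suc k) \<omega>" for \<omega> using k by simp
  ultimately show ?thesis by (simp only:)
qed

text \<open>
  Sums the one-step bound over the run. The same bound also shows by induction that every \<open>f (x k)\<close> is
  integrable: the distance is nonnegative, so one step increases \<open>f\<close> by at most a multiple of
  \<open>15/2 e + 4 noise k\<close>, while \<open>f\<close> is bounded below.
\<close>

lemma average_stationarity:
  fixes e :: real
  assumes c: "maximal_const c" and e: "0 < e"
    and m: "c * ln (real CARD('n)) * \<sigma>\<^sup>2 / real m \<le> e\<^sup>2"
    and \<phi>: "\<phi> = delta {z. norm1 z \<le> 2 * (e / L)}" and \<eta>: "\<eta> = 1 / L" and eps_hat: "eps_hat = e / L"
  shows "\<And>k. k \<in> {1..K} \<Longrightarrow> integrable M (stationarity (Suc k))"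
    and "(\<Sum>k=1..K. expectation (stationarity (Suc k)))
           \<le> real K * (23 / 2 * e) + L / e * (expectation (\<lambda>\<omega>. f (x 1 \<omega>)) - f_low)"
proof -
  have one_step: "stationarity (Suc k) \<omega> \<le> 15 / 2 * e + 4 * noise k \<omega> + L / e * (f (x k \<omega>) - f (x (Suc k) \<omega>))"
    if k: "k \<in> {1..K}" and \<omega>: "\<omega> \<in> space M" for k \<omega>
    unfolding stationarity_def noise_def
  proof (rule disfom_step_stationarity[OF f_differentiable grad_f_lipschitz X_convex L_pos e])
    show "x k \<omega> \<in> X" using k \<omega> by (intro iterate_in_X) auto
    show "disfom_step X (delta {z. norm1 z \<le> 2 * (e / L)}) (1 / L) (e / L) (x k \<omega>)
        (minibatch_grad F m (\<lambda>i. Z k i \<omega>) (x k \<omega>)) (x (Suc k) \<omega>)"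
      using step[OF k \<omega>] by (simp add: \<phi> \<eta> eps_hat)
  qed
  have noise_int: "integrable M (noise k)" "expectation (noise k) \<le> e" if "k \<in> {1..K}" for k
    using noise_first_moment[OF c that e m] by auto
  have f_x_meas: "(\<lambda>\<omega>. f (x k \<omega>)) \<in> borel_measurable M" if "k \<in> {1..Suc K}" for k
    using measurable_compose[OF x_measurable[OF that] borel_measurable_continuous_onI[OF continuous_f]] .
  have f_x_int: "integrable M (\<lambda>\<omega>. f (x (Suc k) \<omega>))" if "k \<le> K" for k
    using that
  proof (induction k)
    case 0
    then show ?case using f_x1_integrable by simp
  next
    case (Suc k)
    then have k: "Suc k \<in> {1..K}" by simp
    show ?case
    proof (rule Bochner_Integration.integrable_bound)
      show "integrable M (\<lambda>\<omega>. \<bar>f_low\<bar> + \<bar>f (x (Suc k) \<omega>)\<bar> + e / L * (15 / 2 * e + 4 * noise (Suc k) \<omega>))"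
        using Suc noise_int[OF k] by auto
      show "(\<lambda>\<omega>. f (x (Suc (Suc k)) \<omega>)) \<in> borel_measurable M"
        using k by (intro f_x_meas) auto
      show "AE \<omega> in M. norm (f (x (Suc (Suc k)) \<omega>))
          \<le> norm (\<bar>f_low\<bar> + \<bar>f (x (Suc k) \<omega>)\<bar> + e / L * (15 / 2 * e + 4 * noise (Suc k) \<omega>))"
      proof (rule AE_I2)
        fix \<omega> assume \<omega>: "\<omega> \<in> space M"
        let ?B = "15 / 2 * e + 4 * noise (Suc k) \<omega>"
        have "0 \<le> ?B" using e by (simp add: noise_def infnorm_pos_le)
        have "0 \<le> ?B + L / e * (f (x (Suc k) \<omega>) - f (x (Suc (Suc k)) \<omega>))"
          using one_step[OF k \<omega>] stationarity_nonneg[of "Suc (Suc k)" \<omega>] k \<omega> by fastforce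
        then have "0 \<le> e / L * (?B + L / e * (f (x (Suc k) \<omega>) - f (x (Suc (Suc k)) \<omega>)))"
          using e L_pos by simp
        then have "f (x (Suc (Suc k)) \<omega>) \<le> f (x (Suc k) \<omega>) + e / L * ?B"
          using e L_pos by (simp add: distrib_left)
        moreover have "f_low \<le> f (x (Suc (Suc k)) \<omega>)"
          using k \<omega> by (intro f_lower_bound iterate_in_X) auto
        moreover have "0 \<le> e / L * ?B"
          using \<open>0 \<le> ?B\<close> e L_pos by (intro mult_nonneg_nonneg) auto
        ultimately have "\<bar>f (x (Suc (Suc k)) \<omega>)\<bar> \<le> \<bar>f_low\<bar> + \<bar>f (x (Suc k) \<omega>)\<bar> + e / L * ?B"
          by linarith
        then show "norm (f (x (Suc (Suc k)) \<omega>)) \<le> norm (\<bar>f_low\<bar> + \<bar>f (x (Suc k) \<omega>)\<bar> + e / L * ?B)"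
          unfolding real_norm_def by (rule order_trans[OF _ abs_ge_self])
      qed
    qed
  qed
  have bound_int: "integrable M (\<lambda>\<omega>. 15 / 2 * e + 4 * noise k \<omega> + L / e * (f (x k \<omega>) - f (x (Suc k) \<omega>)))"
    if "k \<in> {1..K}" for k
    using that noise_int[OF that] f_x_int[of k] f_x_int[of "k - 1"] by auto
  show stat_int: "integrable M (stationarity (Suc k))" if k: "k \<in> {1..K}" for k
  proof (rule Bochner_Integration.integrable_bound[OF bound_int[OF k]])
    show "stationarity (Suc k) \<in> borel_measurable M"
      using k by (intro stationarity_measurable) auto
    show "AE \<omega> in M. norm (stationarity (Suc k) \<omega>)
        \<le> norm (15 / 2 * e + 4 * noise k \<omega> + L / e * (f (x k \<omega>) - f (x (Suc k) \<omega>)))"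
    proof (rule AE_I2)
      fix \<omega> assume \<omega>: "\<omega> \<in> space M"
      have "0 \<le> stationarity (Suc k) \<omega>" using k \<omega> by (intro stationarity_nonneg) auto
      with one_step[OF k \<omega>] show "norm (stationarity (Suc k) \<omega>)
          \<le> norm (15 / 2 * e + 4 * noise k \<omega> + L / e * (f (x k \<omega>) - f (x (Suc k) \<omega>)))"
        by (simp del: of_nat_Suc)
    qed
  qed
  let ?E = "\<lambda>k. expectation (\<lambda>\<omega>. f (x k \<omega>))"
  have "expectation (stationarity (Suc k)) \<le> 23 / 2 * e + L / e * (?E k - ?E (Suc k))"
    if k: "k \<in> {1..K}" for k
  proof -
    have int: "integrable M (\<lambda>\<omega>. f (x k \<omega>))" "integrable M (\<lambda>\<omega>. f (x (Suc k) \<omega>))"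
      using k f_x_int[of k] f_x_int[of "k - 1"] by auto
    have "expectation (stationarity (Suc k))
        \<le> expectation (\<lambda>\<omega>. 15 / 2 * e + 4 * noise k \<omega> + L / e * (f (x k \<omega>) - f (x (Suc k) \<omega>)))"
      by (rule integral_mono[OF stat_int[OF k] bound_int[OF k] one_step[OF k]])
    also have "\<dots> = 15 / 2 * e + 4 * expectation (noise k) + L / e * (?E k - ?E (Suc k))"
      using int noise_int[OF k] by (simp add: prob_space)
    finally show ?thesis using noise_int(2)[OF k] by linarith
  qed
  then have "(\<Sum>k=1..K. expectation (stationarity (Suc k)))
      \<le> (\<Sum>k=1..K. 23 / 2 * e + L / e * (?E k - ?E (Suc k)))"
    by (rule sum_mono)
  also have "\<dots> = real K * (23 / 2 * e) + L / e * (?E 1 - ?E (Suc K))"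
  proof -
    have "(\<Sum>k=1..K. ?E k - ?E (Suc k)) = ?E 1 - ?E (Suc K)"
      using sum_Suc_diff[of 1 K "\<lambda>k. - ?E k"] by simp
    then show ?thesis by (simp only: sum.distrib sum_distrib_left[symmetric]) simp
  qed
  also have "\<dots> \<le> real K * (23 / 2 * e) + L / e * (?E 1 - f_low)"
  proof -
    have "f_low \<le> ?E (Suc K)"
      using f_x_int[of K] iterate_in_X[of "Suc K"] by (intro integral_ge_const) (auto intro!: f_lower_bound)
    then show ?thesis using e L_pos by (intro add_left_mono mult_left_mono) auto
  qed
  finally show "(\<Sum>k=1..K. expectation (stationarity (Suc k)))
      \<le> real K * (23 / 2 * e) + L / e * (expectation (\<lambda>\<omega>. f (x 1 \<omega>)) - f_low)" .
qed

text \<open>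
  For random selection the distance is replaced by its extension by \<open>0\<close>, which is a Borel function of
  the iterate and therefore independent of \<open>Y\<close>.
\<close>

lemma expected_stationarity:
  fixes e :: real
  assumes c: "maximal_const c" and e: "0 < e"
    and m: "c * ln (real CARD('n)) * \<sigma>\<^sup>2 / e\<^sup>2 \<le> real m"
    and K: "(expectation (\<lambda>\<omega>. f (x 1 \<omega>)) - f_low) * L / e\<^sup>2 \<le> real K"
    and \<phi>: "\<phi> = delta {z. norm1 z \<le> 2 * (e / L)}" and \<eta>: "\<eta> = 1 / L" and eps_hat: "eps_hat = e / L"
  shows "integrable M (\<lambda>\<omega>. infdist0 (constrained_subdiff f X (x (Suc (Y \<omega>)) \<omega>)))"
    and "expectation (\<lambda>\<omega>. infdist0 (constrained_subdiff f X (x (Suc (Y \<omega>)) \<omega>))) \<le> 25 / 2 * e"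
proof -
  have "c * ln (real CARD('n)) * \<sigma>\<^sup>2 / real m \<le> e\<^sup>2"
    using m m_pos e by (simp add: field_simps)
  note average = average_stationarity[OF c e this \<phi> \<eta> eps_hat]
  let ?g = "\<lambda>k \<omega>. if x (Suc k) \<omega> \<in> X then infdist0 (constrained_subdiff f X (x (Suc k) \<omega>)) else 0"
  have g: "?g k \<omega> = stationarity (Suc k) \<omega>" if "k \<in> {1..K}" "\<omega> \<in> space M" for k \<omega>
    using stationarity_eq_kernel[of "Suc k" \<omega>] that by simp
  have Y: "Y \<omega> \<in> {1..K}" if "\<omega> \<in> space M" for \<omega>
    using measurable_space[OF Y_measurable that] by simp
  have at_output: "infdist0 (constrained_subdiff f X (x (Suc (Y \<omega>)) \<omega>)) = ?g (Y \<omega>) \<omega>" if "\<omega> \<in> space M" for \<omega>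
    using iterate_in_X[of "Suc (Y \<omega>)" \<omega>] Y[OF that] that by simp
  have g_int: "integrable M (?g k)" if k: "k \<in> {1..K}" for k
    using average(1)[OF k] by (subst Bochner_Integration.integrable_cong[OF refl g[OF k]]) auto
  note random = random_index_expectation[where g="?g", OF Y_measurable Y_uniform index_indep_stationarity g_int]
  show "integrable M (\<lambda>\<omega>. infdist0 (constrained_subdiff f X (x (Suc (Y \<omega>)) \<omega>)))"
    using random(1) by (subst Bochner_Integration.integrable_cong[OF refl at_output]) auto
  have "expectation (\<lambda>\<omega>. infdist0 (constrained_subdiff f X (x (Suc (Y \<omega>)) \<omega>)))
      = expectation (\<lambda>\<omega>. ?g (Y \<omega>) \<omega>)"
    by (rule Bochner_Integration.integral_cong[OF refl at_output])
  also have "\<dots> = (\<Sum>k=1..K. expectation (?g k)) / real K" by (rule random(2))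
  also have "(\<Sum>k=1..K. expectation (?g k)) = (\<Sum>k=1..K. expectation (stationarity (Suc k)))"
    by (intro sum.cong refl Bochner_Integration.integral_cong g)
  also have "\<dots> / real K \<le> (real K * (23 / 2 * e) + L / e * (expectation (\<lambda>\<omega>. f (x 1 \<omega>)) - f_low)) / real K"
    by (intro divide_right_mono average(2)) simp
  also have "\<dots> \<le> (real K * (23 / 2 * e) + real K * e) / real K"
    using K e by (intro divide_right_mono add_left_mono) (simp_all add: field_simps power2_eq_square)
  also have "\<dots> = 25 / 2 * e" using K_pos by (simp add: field_simps)
  finally show "expectation (\<lambda>\<omega>. infdist0 (constrained_subdiff f X (x (Suc (Y \<omega>)) \<omega>))) \<le> 25 / 2 * e" .
qed

end

theorem corollary3:
  fixes M :: "'w measure"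
    and \<Xi> :: "'z::euclidean_space set"
    and \<zeta> :: "'w \<Rightarrow> 'z"
    and F :: "real ^ 'n \<Rightarrow> 'z \<Rightarrow> real"
    and X :: "(real ^ 'n) set"
    and L \<sigma> f_low c \<Delta> \<epsilon> \<eta> eps_hat \<psi> :: real
    and K m :: "real \<Rightarrow> nat"
    and x :: "nat \<Rightarrow> 'w \<Rightarrow> real ^ 'n"
    and Z :: "nat \<Rightarrow> nat \<Rightarrow> 'w \<Rightarrow> 'z"
    and Y :: "'w \<Rightarrow> nat"
  assumes "0 < c" and "maximal_const c"
    and "\<Delta> = (\<integral>\<omega>. objective M \<zeta> F (x 1 \<omega>) \<partial>M) - f_low" and "0 < \<Delta>"
    and "\<And>e. K e = nat \<lceil>\<Delta> * L / e\<^sup>2\<rceil>"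
    and "\<And>e. m e = nat \<lceil>c * ln (real CARD('n)) * \<sigma>\<^sup>2 / e\<^sup>2\<rceil>"
    and "0 < \<epsilon>" and "\<eta> = 1 / L" and "eps_hat = \<epsilon> / L" and "\<psi> = 2 * eps_hat"
    and "disfom_run M \<Xi> \<zeta> F X L \<sigma> f_low
           (delta {z. norm1 z \<le> \<psi>}) \<eta> eps_hat (K \<epsilon>) (m \<epsilon>) x Z Y"
  shows "integrable M (\<lambda>\<omega>. infdist0 (constrained_subdiff (objective M \<zeta> F) X (x (Suc (Y \<omega>)) \<omega>)))
    \<and> (\<integral>\<omega>. infdist0 (constrained_subdiff (objective M \<zeta> F) X (x (Suc (Y \<omega>)) \<omega>)) \<partial>M)
        \<le> 13 * \<epsilon>
    \<and> (\<forall>\<^sub>F e in at_right 0.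
          real (K e * m e) \<le> 4 * (\<Delta> * L * c * ln (real CARD('n)) * \<sigma>\<^sup>2 / e ^ 4))"
proof -
  interpret disfom_run M \<Xi> \<zeta> F X L \<sigma> f_low "delta {z. norm1 z \<le> \<psi>}" \<eta> eps_hat "K \<epsilon>" "m \<epsilon>" x Z Y
    by fact
  have m: "c * ln (real CARD('n)) * \<sigma>\<^sup>2 / \<epsilon>\<^sup>2 \<le> real (m \<epsilon>)"
    unfolding assms(6) by (rule real_nat_ceiling_ge)
  have K: "(expectation (\<lambda>\<omega>. f (x 1 \<omega>)) - f_low) * L / \<epsilon>\<^sup>2 \<le> real (K \<epsilon>)"
    unfolding assms(5) assms(3)[symmetric] by (rule real_nat_ceiling_ge)
  have \<phi>: "delta {z. norm1 z \<le> \<psi>} = delta {z :: real ^ 'n. norm1 z \<le> 2 * (\<epsilon> / L)}"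
    using assms(9,10) by simp
  note stationary = expected_stationarity[OF assms(2,7) m K \<phi> assms(8,9)]
  have "0 < \<Delta> * L" "0 < c * ln (real CARD('n)) * \<sigma>\<^sup>2"
    using assms(1,4) L_pos sigma_pos dim_ge_2 by simp_all
  from eventually_sample_complexity[OF this]
  have "\<forall>\<^sub>F e in at_right 0.
      real (K e * m e) \<le> 4 * (\<Delta> * L * c * ln (real CARD('n)) * \<sigma>\<^sup>2 / e ^ 4)"
    unfolding assms(5,6) by (simp add: mult.assoc)
  with stationary assms(7) show ?thesis by linarith
qed

end
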